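(* Let $A\subset B$ and $B\subset C$ be two finite ring extensions of integral domains, and let $K,L,M$ be the fields of fractions of $A,B,C$, respectively. If $A\subset B$ is projective and the field extension $K\subset L$ is simple, then $$\mathrm{d}_A(C)\leq \mathrm{d}_A(B)\,\mathrm{d}_B(C).$$ If moreover $K\subset L$ is separable, $B\subset C$ is projective and $L\subset M$ is simple, then $$\mathrm{d}_A(C)=\mathrm{d}_A(B)\,\mathrm{d}_B(C).$$
   Context: All rings are commutative with unity. A ring extension $A\subset B$ is finite if $B$ is a finitely generated $A$-module, and projective if $B$ is a projective $A$-module. For an integral ring extension $A\subset B$ of integral domains and $b\in B$, the integral degree of $b$ over $A$, denoted $\mathrm{id}_A(b)$, is the minimum integer $n\geq 1$ such that $b$ is a root of a monic polynomial of degree $n$ in $A[T]$. The integral degree of $B$ over $A$ is $\mathrm{d}_A(B)=\sup\{\mathrm{id}_A(b)\mid b\in B\}$ (possibly $\infty$). A field extension $K\subset L$ is simple if $L=K(\alpha)$ for some $\alpha\in L$. *)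

theory Defs
  imports
    "HOL-Library.Extended_Nat"
    "HOL-Library.Poly_Mapping"
    "HOL-Computational_Algebra.Computational_Algebra"
    "Jordan_Normal_Form.Char_Poly"
begin

text \<open>
  A ring extension \<open>A \<subset> B\<close> is given by an injective homomorphism \<open>f :: 'a \<Rightarrow> 'b\<close> of commutative
  rings, so that in a tower given by \<open>f\<close> and \<open>g\<close> the extension \<open>A \<subset> C\<close> is given by \<open>g \<circ> f\<close>.
\<close>

definition ext_scale :: "('a::comm_ring_1 \<Rightarrow> 'b::comm_ring_1) \<Rightarrow> 'a \<Rightarrow> 'b \<Rightarrow> 'b" where
  "ext_scale f a b = f a * b"

lemma module_ext_scale:
  assumes "inj_comm_ring_hom f"
  shows "Modules.module (ext_scale f)"
proof -
  interpret inj_comm_ring_hom f by (fact assms)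
  show ?thesis
    by (rule Modules.module.intro)
      (simp_all only: ext_scale_def hom_add hom_mult hom_one distrib_left distrib_right mult.assoc mult_1_left)
qed

definition finite_ring_extension :: "('a::comm_ring_1 \<Rightarrow> 'b::comm_ring_1) \<Rightarrow> bool" where
  "finite_ring_extension f \<longleftrightarrow>
     inj_comm_ring_hom f \<and> (\<exists>S. finite S \<and> Modules.module.span (ext_scale f) S = UNIV)"

definition free_scale :: "'a::comm_ring_1 \<Rightarrow> ('i \<Rightarrow>\<^sub>0 'a) \<Rightarrow> ('i \<Rightarrow>\<^sub>0 'a)" where
  "free_scale c = Poly_Mapping.map ((*) c)"

lemma lookup_free_scale: "Poly_Mapping.lookup (free_scale c u) i = c * Poly_Mapping.lookup u i"
  unfolding free_scale_def by transfer (auto simp: when_def)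

lemma module_free_scale: "Modules.module free_scale"
  by (rule Modules.module.intro; rule poly_mapping_eqI)
    (simp_all only: lookup_free_scale lookup_add distrib_left distrib_right mult.assoc mult_1_left)

text \<open>
  A module \<open>P\<close> is projective if it is isomorphic to a direct summand \<open>U\<close> of a free module
  \<open>F = U \<oplus> V\<close>. Taking \<open>F\<close> free on the underlying type of \<open>P\<close> is no restriction: \<open>P\<close> is a quotient
  of that free module, and this quotient map splits whenever \<open>P\<close> is projective.
\<close>

definition projective_module :: "('a::comm_ring_1 \<Rightarrow> 'b::ab_group_add \<Rightarrow> 'b) \<Rightarrow> bool" where
  "projective_module s \<longleftrightarrow>
     (\<exists>(U :: ('b \<Rightarrow>\<^sub>0 'a) set) V \<phi>.
        Modules.module.subspace free_scale U \<and> Modules.module.subspace free_scale V \<and>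
        U \<inter> V = {0} \<and> {u + v | u v. u \<in> U \<and> v \<in> V} = UNIV \<and>
        Modules.module_hom s free_scale \<phi> \<and> bij_betw \<phi> UNIV U)"

definition projective_ring_extension :: "('a::comm_ring_1 \<Rightarrow> 'b::comm_ring_1) \<Rightarrow> bool" where
  "projective_ring_extension f \<longleftrightarrow>
     inj_comm_ring_hom f \<and> projective_module (ext_scale f)"

text \<open>
  The minimum below is over a nonempty set when \<open>b\<close> is integral over \<open>A\<close>; these two definitions
  are meant for integral extensions only (a finite extension is integral).
\<close>

definition integral_degree_elem :: "('a::idom \<Rightarrow> 'b::idom) \<Rightarrow> 'b \<Rightarrow> nat" where
  "integral_degree_elem f b =
     (LEAST n. 1 \<le> n \<and>
        (\<exists>p :: 'a poly. lead_coeff p = 1 \<and> Polynomial.degree p = n \<and> poly (map_poly f p) b = 0))"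

definition integral_degree :: "('a::idom \<Rightarrow> 'b::idom) \<Rightarrow> enat" where
  "integral_degree f = (SUP b. enat (integral_degree_elem f b))"

text \<open>The extension of fraction fields induced by \<open>f\<close>, sending \<open>a / b\<close> to \<open>f a / f b\<close>.\<close>

definition fract_map :: "('a::idom \<Rightarrow> 'b::idom) \<Rightarrow> 'a fract \<Rightarrow> 'b fract" where
  "fract_map f x = (THE y. \<forall>a b. b \<noteq> 0 \<longrightarrow> x = Fract a b \<longrightarrow> y = Fract (f a) (f b))"

lemma fract_map_Fract:
  assumes "inj_comm_ring_hom f" and "b \<noteq> 0"
  shows "fract_map f (Fract a b) = Fract (f a) (f b)"
proof -
  interpret inj_comm_ring_hom f by (fact assms)
  have wd: "Fract (f a) (f b) = Fract (f c) (f d)"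
    if "d \<noteq> 0" "Fract a b = Fract c d" for c d
  proof -
    have "a * d = c * b"
      using that assms(2) by (simp add: eq_fract)
    then have "f a * f d = f c * f b"
      by (metis hom_mult)
    then show ?thesis
      using that(1) assms(2) by (simp add: eq_fract)
  qed
  show ?thesis
    unfolding fract_map_def
  proof (rule the_equality)
    show "\<forall>c d. d \<noteq> 0 \<longrightarrow> Fract a b = Fract c d \<longrightarrow> Fract (f a) (f b) = Fract (f c) (f d)"
      using wd by simp
  qed (use assms(2) in simp)
qed

lemma inj_comm_ring_hom_fract_map:
  assumes "inj_comm_ring_hom f"
  shows "inj_comm_ring_hom (fract_map f)"
proof -
  interpret inj_comm_ring_hom f by (fact assms)
  note [simp] = fract_map_Fract[OF assms]
  show ?thesis
  proof
    show "fract_map f 0 = 0" "fract_map f 1 = 1"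
      by (simp_all add: Zero_fract_def One_fract_def)
    fix x y
    show "fract_map f (x + y) = fract_map f x + fract_map f y"
      by (cases x; cases y) (simp add: hom_add hom_mult)
    show "fract_map f (x * y) = fract_map f x * fract_map f y"
      by (cases x; cases y) (simp add: hom_mult)
    show "x = 0" if "fract_map f x = 0"
      using that by (cases x) (auto simp: Zero_fract_def eq_fract)
  qed
qed

definition is_subfield :: "'a::field set \<Rightarrow> bool" where
  "is_subfield F \<longleftrightarrow>
     0 \<in> F \<and> 1 \<in> F \<and> (\<forall>x\<in>F. \<forall>y\<in>F. x - y \<in> F \<and> x * y \<in> F) \<and> (\<forall>x\<in>F. inverse x \<in> F)"

definition simple_field_extension :: "('k::field \<Rightarrow> 'l::field) \<Rightarrow> bool" where
  "simple_field_extension h \<longleftrightarrow>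
     (\<exists>\<alpha>. is_subfield hull (insert \<alpha> (range h)) = UNIV)"

text \<open>
  Separable (algebraic) field extension: the minimal polynomial of every element, that is, the
  monic irreducible polynomial having it as a root, is coprime to its derivative.
\<close>

definition separable_field_extension :: "('k::field \<Rightarrow> 'l::field) \<Rightarrow> bool" where
  "separable_field_extension h \<longleftrightarrow>
     (\<forall>x. \<exists>p :: 'k poly. lead_coeff p = 1 \<and> irreducible p \<and> poly (map_poly h p) x = 0 \<and>
        coprime p (pderiv p))"

end

theory Submission
  imports Defs "HOL-Algebra.Algebraic_Closure_Type" "HOL-Algebra.Multiplicative_Group"
begin

text \<open>
  A finite projective \<open>A\<close>-module of rank \<open>s\<close> has a finite dual basis, so an endomorphism
  is described by a matrix \<open>W\<close> over \<open>A\<close>, of some size \<open>r\<close>, which factors over the fraction field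
  through a space of dimension \<open>s\<close>. Hence \<open>X\<^sup>r\<^sup>-\<^sup>s\<close> divides the characteristic polynomial of \<open>W\<close>, and the
  quotient is monic of degree \<open>s\<close> with coefficients in \<open>A\<close>. If \<open>c \<in> C\<close> is a root of a monic \<open>p \<in> B[T]\<close>
  of degree \<open>n\<close>, this applies to multiplication by \<open>T\<close> on \<open>B[T]/(p)\<close>, of rank \<open>[L:K] n\<close> over \<open>A\<close>,
  and gives \<open>id\<^sub>A(c) \<le> [L:K] n\<close>; for \<open>C = B\<close> it gives \<open>d\<^sub>A(B) \<le> [L:K]\<close>. Conversely, clearing
  denominators in a generator of \<open>L\<close> yields \<open>L = K(\<beta>)\<close> with \<open>\<beta> \<in> B\<close>, so that \<open>d\<^sub>A(B) \<ge> [L:K]\<close>.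
  In the separable case the primitive element theorem makes \<open>K \<subset> M\<close> simple, so
  \<open>d\<^sub>A(C) \<ge> [M:K] = [M:L] [L:K]\<close>.
\<close>

hide_const (open) UnivPoly.coeff UnivPoly.monom Module.smult Coset.order Polynomials.degree Polynomials.lead_coeff

subsection \<open>Characteristic polynomials of matrices of low rank\<close>

text \<open>Both sides are \<open>monom 1 s\<close> times the determinant of one block matrix, with
  \<open>Q\<close> eliminated once by column and once by row operations. For \<open>s < N\<close>
  the identity forces a power of \<open>X\<close> to divide the characteristic polynomial of a
  product through dimension \<open>s\<close>.\<close>

lemma char_poly_mult_commute:
  fixes P Q :: "'a :: idom mat"
  assumes P: "P \<in> carrier_mat N s" and Q: "Q \<in> carrier_mat s N"
  shows "monom 1 s * char_poly (P * Q) = monom 1 N * char_poly (Q * P)"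
proof -
  define c :: "'a mat \<Rightarrow> 'a poly mat" where "c = map_mat (\<lambda>a. [:a:])"
  interpret c: comm_ring_hom "\<lambda>a::'a. [:a:]" by unfold_locales auto
  let ?X = "\<lambda>n. [:0, 1:] \<cdot>\<^sub>m 1\<^sub>m n :: 'a poly mat"
  let ?T = "four_block_mat (?X N) (c P) (c Q) (1\<^sub>m s)"
  have [simp]: "c P \<in> carrier_mat N s" "c Q \<in> carrier_mat s N" using P Q by (auto simp: c_def)
  have [simp]: "c P * c Q \<in> carrier_mat N N" "c Q * c P \<in> carrier_mat s s"
    using mult_carrier_mat[of "c P" N s "c Q" N] mult_carrier_mat[of "c Q" s N "c P" s] by simp_all
  have [simp]: "dim_row (c P) = N" "dim_col (c P) = s" "dim_row (c Q) = s" "dim_col (c Q) = N"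
    using P Q by (auto simp: c_def)
  have cp: "char_poly A = det (?X n - c A)" if "A \<in> carrier_mat n n" for n and A :: "'a mat"
    unfolding char_poly_defs c_def using that by (intro arg_cong[of _ _ det] eq_matI) auto
  have cm: "c (A * B) = c A * c B" if "A \<in> carrier_mat n k" "B \<in> carrier_mat k l" for A B n k l
    unfolding c_def using c.mat_hom_mult[OF that] .
  have detX: "det (?X n) = monom 1 n" for n
    by (simp add: monom_altdef)
  \<comment> \<open>Multiplying \<open>?T\<close> by \<open>?R\<close> on the right and by \<open>?L\<close> on the left clears its lower left block.\<close>
  let ?L = "four_block_mat (1\<^sub>m N) (0\<^sub>m N s) (- c Q) (?X s)"
  let ?R = "four_block_mat (1\<^sub>m N) (0\<^sub>m N s) (- c Q) (1\<^sub>m s)"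
  have 1: "?T * ?R = four_block_mat (?X N - c P * c Q) (c P) (0\<^sub>m s N) (1\<^sub>m s)"
    by (subst mult_four_block_mat[where ?nr1.0=N and ?n1.0=N and ?n2.0=s and ?nr2.0=s and ?nc1.0=N and ?nc2.0=s])
      (auto intro!: cong_four_block_mat simp: add_uminus_minus_mat[of _ N N])
  have 2: "?L * ?T = four_block_mat (?X N) (c P) (0\<^sub>m s N) (?X s - c Q * c P)"
    by (subst mult_four_block_mat[where ?nr1.0=N and ?n1.0=N and ?n2.0=s and ?nr2.0=s and ?nc1.0=N and ?nc2.0=s])
      (auto intro!: cong_four_block_mat eq_matI simp: mult_smult_distrib[of _ s N _ N] mult_smult_assoc_mat[of _ s s _ N])
  have L: "det ?L = monom 1 s"
    by (subst det_four_block_mat_upper_right_zero[of _ N _ s]) (simp_all only: detX, auto)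
  have R: "det ?R = 1"
    by (subst det_four_block_mat_upper_right_zero[of _ N _ s]) auto
  have dT: "det (?T * ?R) = det ?T * det ?R" and dT': "det (?L * ?T) = det ?L * det ?T"
    by (auto intro!: det_mult[of _ "N+s"])
  have TR: "det (?T * ?R) = det (?X N - c P * c Q)"
    unfolding 1 by (subst det_four_block_mat_lower_left_zero[of _ N _ s]) auto
  have LT: "det (?L * ?T) = monom 1 N * det (?X s - c Q * c P)"
    unfolding 2 by (subst det_four_block_mat_lower_left_zero[of _ N _ s]) (simp_all only: detX, auto)
  have "monom 1 s * det (?X N - c P * c Q) = monom 1 N * det (?X s - c Q * c P)"
    using dT dT' unfolding TR LT L R by (simp only: mult_1_right)
  moreover have "char_poly (P * Q) = det (?X N - c P * c Q)"
    using P Q by (subst cp[of _ N]) (simp_all only: cm[OF P Q], simp)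
  moreover have "char_poly (Q * P) = det (?X s - c Q * c P)"
    using P Q by (subst cp[of _ s]) (simp_all only: cm[OF Q P], simp)
  ultimately show ?thesis by (simp only:)
qed

text \<open>The eigenvalue criterion is applied over the fraction field of \<open>'c\<close>, and
  injectivity of \<open>to_fract\<close> brings the root back.\<close>

lemma eigen_root_char_poly:
  fixes F :: "'a::idom \<Rightarrow> 'c::idom" and A :: "'a mat"
  assumes F: "inj_comm_ring_hom F" and A: "A \<in> carrier_mat N N"
    and v: "v \<in> carrier_vec N" "v \<noteq> 0\<^sub>v N" "map_mat F A *\<^sub>v v = c \<cdot>\<^sub>v v"
  shows "poly (map_poly F (char_poly A)) c = 0"
proof -
  interpret F: inj_comm_ring_hom F by fact
  interpret T: inj_comm_ring_hom "to_fract :: 'c \<Rightarrow> 'c fract" by unfold_locales auto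
  let ?A = "map_mat to_fract (map_mat F A) :: 'c fract mat"
  have A': "map_mat F A \<in> carrier_mat N N" using A by simp
  have "?A *\<^sub>v map_vec to_fract v = to_fract c \<cdot>\<^sub>v map_vec to_fract v"
    using T.mult_mat_vec_hom[OF A' v(1)] v(3) by (simp add: T.vec_hom_smult)
  moreover have "map_vec to_fract v \<noteq> (0\<^sub>v N :: 'c fract vec)"
    using v by (metis T.vec_hom_zero_iff)
  ultimately have "eigenvalue ?A (to_fract c)"
    using v A unfolding eigenvalue_def eigenvector_def by (intro exI[of _ "map_vec to_fract v"]) auto
  hence "poly (char_poly ?A) (to_fract c) = 0"
    using A' by (subst (asm) eigenvalue_root_char_poly[of _ N]) auto
  hence "to_fract (poly (map_poly F (char_poly A)) c) = 0"
    by (simp add: T.char_poly_hom[OF A'] F.char_poly_hom[OF A] T.poly_map_poly)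
  thus ?thesis by simp
qed

text \<open>The entries of \<open>P\<close> and \<open>Q\<close> lie only in the fraction field, but
  they serve merely to show that low coefficients vanish; \<open>q\<close> is then a shift of
  coefficients and stays over \<open>'a\<close>. Keeping \<open>monom 1 s\<close> on the left avoids
  comparing \<open>s\<close> with \<open>N\<close>.\<close>

lemma char_poly_low_rank_factor:
  fixes P Q :: "'a :: idom fract mat" and A :: "'a mat"
  assumes P: "P \<in> carrier_mat N s" and Q: "Q \<in> carrier_mat s N" and A: "A \<in> carrier_mat N N"
    and PQ: "map_mat to_fract A = P * Q"
  obtains q where "monom 1 s * char_poly A = monom 1 N * q" "degree q = s" "lead_coeff q = 1"
proof -
  interpret T: inj_comm_ring_hom "to_fract :: 'a \<Rightarrow> 'a fract" by unfold_locales auto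
  interpret MT: map_poly_inj_comm_ring_hom "to_fract :: 'a \<Rightarrow> 'a fract" by unfold_locales
  let ?M = "monom 1 s * char_poly A"
  have "map_poly to_fract ?M = monom 1 N * char_poly (Q * P)"
    using char_poly_mult_commute[OF P Q] by (simp add: MT.hom_mult T.char_poly_hom[OF A, symmetric] PQ)
  hence Y: "coeff (map_poly to_fract ?M) i = 0" if "i < N" for i
    using that by (simp only: coeff_monom_mult) simp
  hence Z: "coeff ?M i = 0" if "i < N" for i
    using Y[OF that] by (simp only: T.coeff_map_poly_hom to_fract_eq_0_iff)
  define q where "q = poly_shift N ?M"
  have 1: "?M = monom 1 N * q"
    using Z by (intro poly_eqI) (auto simp: q_def coeff_monom_mult coeff_poly_shift simp del: mult_1_left)
  have m: "degree (char_poly A) = N" "lead_coeff (char_poly A) = 1"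
    using degree_monic_char_poly[OF A] by auto
  have "lead_coeff (monom 1 N * q) = 1" unfolding 1[symmetric] using m
    by (simp add: lead_coeff_mult degree_monom_eq)
  hence 2: "lead_coeff q = 1" by (simp add: lead_coeff_mult degree_monom_eq)
  have "degree (monom 1 N * q) = s + N"  unfolding 1[symmetric] using m
    by (subst degree_mult_eq) (auto simp: degree_monom_eq)
  hence "degree q = s" using 2
    by (subst (asm) degree_mult_eq) (auto simp: degree_monom_eq)
  thus ?thesis using that 1 2 by blast
qed

lemma eigen_root_char_poly_index:
  fixes F :: "'a::idom \<Rightarrow> 'c::idom" and M :: "nat \<Rightarrow> nat \<Rightarrow> 'a"
  assumes F: "inj_comm_ring_hom F"
    and eig: "\<And>i. i < N \<Longrightarrow> (\<Sum>j<N. F (M i j) * v j) = c * v i"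
    and v: "k < N" "v k \<noteq> 0"
  shows "poly (map_poly F (char_poly (mat N N (\<lambda>(i, j). M i j)))) c = 0"
proof (rule eigen_root_char_poly[OF F, of _ N "vec N v"])
  show "vec N v \<noteq> 0\<^sub>v N"
  proof
    assume "vec N v = 0\<^sub>v N"
    hence "vec N v $ k = 0\<^sub>v N $ k" by simp
    thus False using v by simp
  qed
  show "map_mat F (mat N N (\<lambda>(i, j). M i j)) *\<^sub>v vec N v = c \<cdot>\<^sub>v vec N v"
    using eig by (intro eq_vecI) (auto simp: scalar_prod_def lessThan_atLeast0)
qed auto

text \<open>The determinant trick: \<open>c\<close> is an eigenvalue of a matrix over the base ring,
  hence a root of its characteristic polynomial.\<close>

lemma eigen_imp_integral:
  fixes F :: "'a::idom \<Rightarrow> 'c::idom" and M :: "'i \<Rightarrow> 'i \<Rightarrow> 'a"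
  assumes F: "inj_comm_ring_hom F" and I: "finite I"
    and eig: "\<And>i. i \<in> I \<Longrightarrow> (\<Sum>j\<in>I. F (M i j) * v j) = c * v i"
    and v: "k \<in> I" "v k \<noteq> 0"
  obtains q where "lead_coeff q = 1" "degree q = card I" "poly (map_poly F q) c = 0"
proof -
  obtain b where b: "bij_betw b {..<card I} I"
    using ex_bij_betw_nat_finite[OF I] by (auto simp: lessThan_atLeast0)
  have bI: "b i \<in> I" if "i < card I" for i
    using bij_betwE[OF b] that by auto
  obtain k' where k': "k' < card I" "b k' = k"
    using b v(1) unfolding bij_betw_def by (metis imageE lessThan_iff)
  let ?A = "mat (card I) (card I) (\<lambda>(i, j). M (b i) (b j))"
  have "poly (map_poly F (char_poly ?A)) c = 0"
    using k' v eig[OF bI]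
    by (intro eigen_root_char_poly_index[OF F, where v = "v \<circ> b" and k = k'])
       (auto simp: sum.reindex_bij_betw[OF b, of "\<lambda>j. F (M (b _) j) * v j"])
  moreover have "lead_coeff (char_poly ?A) = 1" "degree (char_poly ?A) = card I"
    using degree_monic_char_poly[of ?A "card I"] by auto
  ultimately show thesis using that by blast
qed

text \<open>In the determinant trick, the size of the matrix is replaced as degree by the dimension
  through which the matrix factors over the fraction field.\<close>

lemma factored_eigen_imp_integral:
  fixes F :: "'a::idom \<Rightarrow> 'c::idom" and M :: "'i \<Rightarrow> 'i \<Rightarrow> 'a"
    and P :: "'i \<Rightarrow> 'j \<Rightarrow> 'a fract" and Q :: "'j \<Rightarrow> 'i \<Rightarrow> 'a fract"
  assumes F: "inj_comm_ring_hom F" and I: "finite I" and J: "finite J"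
    and PQ: "\<And>i j. i \<in> I \<Longrightarrow> j \<in> I \<Longrightarrow> to_fract (M i j) = (\<Sum>k\<in>J. P i k * Q k j)"
    and eig: "\<And>i. i \<in> I \<Longrightarrow> (\<Sum>j\<in>I. F (M i j) * v j) = c * v i"
    and v: "k \<in> I" "v k \<noteq> 0" and c: "c \<noteq> 0"
  obtains q where "lead_coeff q = 1" "degree q = card J" "poly (map_poly F q) c = 0"
proof -
  interpret F: inj_comm_ring_hom F by fact
  interpret FM: map_poly_inj_comm_ring_hom F by unfold_locales
  obtain b where b: "bij_betw b {..<card I} I"
    using ex_bij_betw_nat_finite[OF I] by (auto simp: lessThan_atLeast0)
  obtain d where d: "bij_betw d {..<card J} J"
    using ex_bij_betw_nat_finite[OF J] by (auto simp: lessThan_atLeast0)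
  have bI: "b i \<in> I" if "i < card I" for i
    using bij_betwE[OF b] that by auto
  obtain k' where k': "k' < card I" "b k' = k"
    using b v(1) unfolding bij_betw_def by (metis imageE lessThan_iff)
  let ?A = "mat (card I) (card I) (\<lambda>(i, j). M (b i) (b j))"
  have root: "poly (map_poly F (char_poly ?A)) c = 0"
    using k' v eig[OF bI]
    by (intro eigen_root_char_poly_index[OF F, where v = "v \<circ> b" and k = k'])
       (auto simp: sum.reindex_bij_betw[OF b, of "\<lambda>j. F (M (b _) j) * v j"])
  have "map_mat to_fract ?A =
    mat (card I) (card J) (\<lambda>(i, j). P (b i) (d j)) * mat (card J) (card I) (\<lambda>(i, j). Q (d i) (b j))"
    by (intro eq_matI)
       (auto simp: PQ bI scalar_prod_def lessThan_atLeast0[symmetric]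
          sum.reindex_bij_betw[OF d, of "\<lambda>k. P (b _) k * Q k (b _)"])
  then obtain q
    where q: "monom 1 (card J) * char_poly ?A = monom 1 (card I) * q" "degree q = card J" "lead_coeff q = 1"
    by (rule char_poly_low_rank_factor[rotated 3]) auto
  have "poly (map_poly F (monom 1 (card I) * q)) c = 0"
    unfolding q(1)[symmetric] by (simp add: root FM.hom_mult)
  \<comment> \<open>The monomial evaluates to \<open>c ^ card I\<close>, which cancels because
    \<open>c\<close> is nonzero.\<close>
  hence "poly (map_poly F q) c = 0" using c by (simp add: FM.hom_mult poly_monom)
  thus thesis using that q by blast
qed

subsection \<open>Dual bases and integrality\<close>

text \<open>The embedding \<open>\<theta>\<close> into a free module has a retraction. The
  functionals are the coordinates of \<open>\<theta> b\<close>, the elements \<open>x i\<close> are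
  the images of the unit vectors under the retraction, and finite generation leaves finitely many
  coordinates.\<close>

lemma projective_module_dual_basis:
  fixes s :: "'a::comm_ring_1 \<Rightarrow> 'b::ab_group_add \<Rightarrow> 'b"
  assumes m: "Modules.module s" and proj: "projective_module s"
    and S: "finite S" "Modules.module.span s S = UNIV"
  obtains T :: "'b set" and x \<phi> where "finite T"
    "\<And>i b b'. \<phi> i (b + b') = \<phi> i b + \<phi> i b'" "\<And>i a b. \<phi> i (s a b) = a * \<phi> i b"
    "\<And>b. b = (\<Sum>i\<in>T. s (\<phi> i b) (x i))"
proof -
  obtain U :: "('b \<Rightarrow>\<^sub>0 'a) set" and V \<theta> where U: "Modules.module.subspace free_scale U"
    and V: "Modules.module.subspace free_scale V" and UV: "U \<inter> V = {0}"
    and sum: "{u + v | u v. u \<in> U \<and> v \<in> V} = UNIV"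
    and hom: "Modules.module_hom s free_scale \<theta>" and bij: "bij_betw \<theta> UNIV U"
    using proj unfolding projective_module_def by blast
  interpret B: Modules.module s by fact
  interpret W: Modules.module "free_scale :: 'a \<Rightarrow> ('b \<Rightarrow>\<^sub>0 'a) \<Rightarrow> _" by (rule module_free_scale)
  interpret h: Modules.module_hom s free_scale \<theta> by fact
  have ex: "\<exists>!b. w - \<theta> b \<in> V" for w
  proof -
    obtain u v where uv: "w = u + v" "u \<in> U" "v \<in> V" using sum by blast
    then obtain b where b: "u = \<theta> b" using bij by (auto simp: bij_betw_def)
    show ?thesis
    proof (rule ex1I[of _ b])
      show "w - \<theta> b \<in> V" using uv b by simp
    next
      fix b' assume "w - \<theta> b' \<in> V"
      hence "(w - \<theta> b') - v \<in> V" using W.subspace_diff[OF V _ uv(3)] by blast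
      hence "\<theta> b - \<theta> b' \<in> V" by (simp add: uv b algebra_simps)
      moreover have "\<theta> b - \<theta> b' \<in> U"
        using bij W.subspace_diff[OF U] by (auto simp: bij_betw_def)
      ultimately have "\<theta> b - \<theta> b' \<in> U \<inter> V" by blast
      hence "\<theta> b = \<theta> b'" unfolding UV by simp
      thus "b' = b" using bij by (auto simp: bij_betw_def inj_on_def)
    qed
  qed
  \<comment> \<open>The projection onto \<open>U\<close> along \<open>V\<close>, followed by the
    inverse of \<open>\<theta>\<close>. Described by the single condition
    \<open>w - \<theta> b \<in> V\<close>, it is easily seen to be linear.\<close>
  define \<psi> where "\<psi> w = (THE b. w - \<theta> b \<in> V)" for w
  have \<psi>V: "w - \<theta> (\<psi> w) \<in> V" for w unfolding \<psi>_def by (rule theI'[OF ex])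
  have \<psi>I: "\<psi> w = b" if "w - \<theta> b \<in> V" for w b
    using ex[of w] that \<psi>V by blast
  have \<psi>\<theta>: "\<psi> (\<theta> b) = b" for b by (rule \<psi>I) (simp add: W.subspace_0[OF V])
  interpret \<psi>: Modules.module_hom free_scale s \<psi>
  proof
    show "\<psi> (w + w') = \<psi> w + \<psi> w'" for w w'
      using W.subspace_add[OF V \<psi>V[of w] \<psi>V[of w']] by (intro \<psi>I) (simp add: h.add algebra_simps)
    show "\<psi> (free_scale c w) = s c (\<psi> w)" for c w
      using W.subspace_scale[OF V \<psi>V[of w], of c]
      by (intro \<psi>I) (simp add: h.scale W.scale_right_diff_distrib)
  qed
  \<comment> \<open>Vectors supported in a fixed set form a submodule, so the supports of the images
    of the generators bound all supports.\<close>
  define T where "T = (\<Union>b\<in>S. Poly_Mapping.keys (\<theta> b))"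
  have T: "finite T" unfolding T_def using S(1) by auto
  have keys: "Poly_Mapping.keys (\<theta> b) \<subseteq> T" for b
  proof -
    have sub: "B.subspace {b. Poly_Mapping.keys (\<theta> b) \<subseteq> T}"
    proof (rule B.subspaceI)
      show "0 \<in> {b. Poly_Mapping.keys (\<theta> b) \<subseteq> T}" by (simp add: h.zero)
      show "x + y \<in> {b. Poly_Mapping.keys (\<theta> b) \<subseteq> T}"
        if "x \<in> {b. Poly_Mapping.keys (\<theta> b) \<subseteq> T}" "y \<in> {b. Poly_Mapping.keys (\<theta> b) \<subseteq> T}" for x y
        using that Poly_Mapping.keys_add[of "\<theta> x" "\<theta> y"] by (auto simp: h.add)
      show "s c x \<in> {b. Poly_Mapping.keys (\<theta> b) \<subseteq> T}"
        if "x \<in> {b. Poly_Mapping.keys (\<theta> b) \<subseteq> T}" for c x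
      proof -
        have "Poly_Mapping.keys (free_scale c (\<theta> x)) \<subseteq> Poly_Mapping.keys (\<theta> x)"
          by (auto simp: in_keys_iff lookup_free_scale)
        thus ?thesis using that by (auto simp: h.scale)
      qed
    qed
    have "S \<subseteq> {b. Poly_Mapping.keys (\<theta> b) \<subseteq> T}" by (auto simp: T_def)
    from B.span_minimal[OF this sub] S(2) show ?thesis by auto
  qed
  define x where "x i = \<psi> (Poly_Mapping.single i 1)" for i
  define \<phi> where "\<phi> i b = Poly_Mapping.lookup (\<theta> b) i" for i b
  have rep: "b = (\<Sum>i\<in>T. s (\<phi> i b) (x i))" for b
  proof -
    have "\<theta> b = (\<Sum>i\<in>T. free_scale (\<phi> i b) (Poly_Mapping.single i 1))"
    proof (rule poly_mapping_eqI)
      fix k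
      have "(\<Sum>i\<in>T. \<phi> i b * (1 when i = k)) = (\<Sum>i\<in>T. if i = k then \<phi> i b else 0)"
        by (intro sum.cong) (auto simp: when_def)
      also have "\<dots> = \<phi> k b"
        using T keys[of b] by (auto simp: \<phi>_def in_keys_iff)
      finally show "Poly_Mapping.lookup (\<theta> b) k =
          Poly_Mapping.lookup (\<Sum>i\<in>T. free_scale (\<phi> i b) (Poly_Mapping.single i 1)) k"
        by (simp add: lookup_sum lookup_free_scale lookup_single \<phi>_def)
    qed
    hence "\<psi> (\<theta> b) = (\<Sum>i\<in>T. s (\<phi> i b) (x i))"
      by (simp add: \<psi>.sum \<psi>.scale x_def)
    thus ?thesis by (simp add: \<psi>\<theta>)
  qed
  show thesis
    by (rule that[OF T _ _ rep]) (simp_all add: \<phi>_def h.add h.scale lookup_add lookup_free_scale)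
qed

text \<open>The determinant trick applies to multiplication by \<open>b\<close>, with the finite
  generating set itself as eigenvector.\<close>

lemma finite_ring_extension_integral:
  fixes f :: "'a::idom \<Rightarrow> 'b::idom"
  assumes "finite_ring_extension f"
  shows "\<exists>p. lead_coeff p = 1 \<and> degree p > 0 \<and> poly (map_poly f p) b = 0"
proof -
  from assms obtain S where f: "inj_comm_ring_hom f" and S: "finite S" "Modules.module.span (ext_scale f) S = UNIV"
    unfolding finite_ring_extension_def by blast
  interpret M: Modules.module "ext_scale f" by (rule module_ext_scale) fact
  have "\<forall>x. \<exists>u. x = (\<Sum>v\<in>S. f (u v) * v)"
    using S by (auto simp: M.span_finite image_iff ext_scale_def)
  then obtain u where u: "\<And>x. x = (\<Sum>v\<in>S. f (u x v) * v)" by metis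
  \<comment> \<open>Since \<open>1\<close> is nonzero, some generator is nonzero. This gives both a
    nonzero eigenvector and a positive degree.\<close>
  obtain k where k: "k \<in> S" "k \<noteq> 0"
    using u[of 1] by (metis mult_zero_right sum.neutral zero_neq_one)
  obtain q where "lead_coeff q = 1" "degree q = card S" "poly (map_poly f q) b = 0"
    using eigen_imp_integral[OF f S(1), of "\<lambda>x. u (b * x)" "\<lambda>x. x" b k] u[symmetric] k by blast
  moreover have "card S > 0" using k S by (auto simp: card_gt_0_iff)
  ultimately show ?thesis by metis
qed

subsection \<open>Simple field extensions\<close>

text \<open>Polynomial values suffice in place of quotients: for algebraic \<open>\<alpha>\<close>
  they already form a field.\<close>

definition generates :: "('k::field \<Rightarrow> 'l::field) \<Rightarrow> 'l \<Rightarrow> bool" where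
  "generates h \<alpha> \<longleftrightarrow> (\<forall>x. \<exists>p. poly (map_poly h p) \<alpha> = x)"

definition algebraic_over :: "('k::field \<Rightarrow> 'l::field) \<Rightarrow> 'l \<Rightarrow> bool" where
  "algebraic_over h \<alpha> \<longleftrightarrow> (\<exists>p. p \<noteq> 0 \<and> poly (map_poly h p) \<alpha> = 0)"

text \<open>The powers of \<open>\<alpha>\<close> below \<open>m\<close> form a basis of the
  extension: the second clause is independence, the third is spanning. So \<open>m\<close> is the
  degree of the field extension.\<close>

definition generates_with_degree :: "('k::field \<Rightarrow> 'l::field) \<Rightarrow> 'l \<Rightarrow> nat \<Rightarrow> bool" where
  "generates_with_degree h \<alpha> m \<longleftrightarrow> 0 < m \<and>
     (\<forall>p. p \<noteq> 0 \<longrightarrow> poly (map_poly h p) \<alpha> = 0 \<longrightarrow> m \<le> degree p) \<and>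
     (\<forall>x. \<exists>p. degree p < m \<and> poly (map_poly h p) \<alpha> = x)"

lemma algebraic_over_minimal:
  assumes "algebraic_over h \<alpha>"
  obtains \<mu> where "\<mu> \<noteq> 0" "poly (map_poly h \<mu>) \<alpha> = 0"
    "\<And>p. p \<noteq> 0 \<Longrightarrow> poly (map_poly h p) \<alpha> = 0 \<Longrightarrow> degree \<mu> \<le> degree p"
proof -
  let ?P = "\<lambda>p. p \<noteq> 0 \<and> poly (map_poly h p) \<alpha> = 0"
  obtain p where "?P p" using assms unfolding algebraic_over_def by blast
  then obtain \<mu> where "?P \<mu>" "\<And>p. ?P p \<Longrightarrow> degree \<mu> \<le> degree p"
    using ex_has_least_nat[of ?P p degree] by metis
  thus thesis using that by metis
qed

section \<open>Polynomial expressions in an algebraic element\<close>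

context
  fixes h :: "'k::field \<Rightarrow> 'l::field"
  assumes h: "inj_comm_ring_hom h"
begin

interpretation h: inj_comm_ring_hom h by (fact h)
interpretation hp: map_poly_inj_comm_ring_hom h by unfold_locales

lemma poly_map_mod:
  assumes "poly (map_poly h \<mu>) \<alpha> = 0"
  shows "poly (map_poly h (p mod \<mu>)) \<alpha> = poly (map_poly h p) \<alpha>"
proof -
  have "poly (map_poly h (\<mu> * (p div \<mu>) + p mod \<mu>)) \<alpha> = poly (map_poly h (p mod \<mu>)) \<alpha>"
    using assms by (simp only: hp.hom_add hp.hom_mult poly_add poly_mult) simp
  thus ?thesis by simp
qed

lemma degree_minimal_pos:
  assumes "\<mu> \<noteq> 0" "poly (map_poly h \<mu>) \<alpha> = 0"
  shows "degree \<mu> > 0"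
proof (rule ccontr)
  assume "\<not> degree \<mu> > 0"
  hence "degree \<mu> = 0" by simp
  then obtain a where "\<mu> = [:a:]" by (rule degree_eq_zeroE)
  thus False using assms by simp
qed

text \<open>Descent by division: for \<open>p\<close> of degree below that of the minimal polynomial
  \<open>\<mu>\<close>, the remainder of \<open>\<mu>\<close> by \<open>p\<close> has smaller
  degree, and inverting its value inverts that of \<open>p\<close>. A general \<open>p\<close> is
  first reduced modulo \<open>\<mu>\<close>.\<close>

lemma algebraic_over_inverse:
  assumes alg: "algebraic_over h \<alpha>" and p: "poly (map_poly h p) \<alpha> \<noteq> 0"
  shows "\<exists>r. poly (map_poly h r) \<alpha> = inverse (poly (map_poly h p) \<alpha>)"
proof -
  obtain \<mu> where \<mu>: "\<mu> \<noteq> 0" "poly (map_poly h \<mu>) \<alpha> = 0"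
    "\<And>p. p \<noteq> 0 \<Longrightarrow> poly (map_poly h p) \<alpha> = 0 \<Longrightarrow> degree \<mu> \<le> degree p"
    using algebraic_over_minimal[OF alg] by blast
  have small: "\<exists>r. poly (map_poly h (r * p)) \<alpha> = 1"
    if "degree p < degree \<mu>" "poly (map_poly h p) \<alpha> \<noteq> 0" for p
    using that
  proof (induction "degree p" arbitrary: p rule: less_induct)
    case (less p)
    show ?case
    proof (cases "degree p = 0")
      case True
      then obtain a where a: "p = [:a:]" by (rule degree_eq_zeroE)
      with less.prems have "a \<noteq> 0" by auto
      thus ?thesis by (intro exI[of _ "[:inverse a:]"]) (simp add: a h.hom_mult[symmetric])
    next
      case False
      let ?r = "\<mu> mod p" and ?q = "\<mu> div p"
      have p0: "p \<noteq> 0" using False by auto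
      have eq: "\<mu> = ?q * p + ?r" by simp
      have rdeg: "degree ?r < degree p" using degree_mod_less'[OF p0, of \<mu>] False by (cases "?r = 0") auto
      \<comment> \<open>Otherwise minimality makes the remainder zero, and then \<open>?q\<close>
        vanishes at \<open>\<alpha>\<close> with degree smaller than that of
        \<open>\<mu>\<close>.\<close>
      have "poly (map_poly h ?r) \<alpha> \<noteq> 0"
      proof
        assume "poly (map_poly h ?r) \<alpha> = 0"
        moreover have "\<not> degree \<mu> \<le> degree ?r" using less_trans[OF rdeg less.prems(1)] by simp
        ultimately have "?r = 0" using \<mu>(3) by blast
        hence eq': "\<mu> = ?q * p" using eq by simp
        hence "poly (map_poly h ?q) \<alpha> * poly (map_poly h p) \<alpha> = 0"
          using hp.hom_mult[of ?q p] \<mu>(2) unfolding eq'[symmetric] by simp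
        hence "poly (map_poly h ?q) \<alpha> = 0" using less.prems by simp
        moreover have q0: "?q \<noteq> 0" using eq' \<mu>(1) by auto
        ultimately have "degree \<mu> \<le> degree ?q" using \<mu>(3) by blast
        moreover have "degree \<mu> = degree ?q + degree p"
          using degree_mult_eq[OF q0 p0] eq' by simp
        ultimately show False using False by simp
      qed
      from less.hyps[OF rdeg _ this] obtain u where u: "poly (map_poly h (u * ?r)) \<alpha> = 1"
        using less_trans[OF rdeg less.prems(1)] by blast
      \<comment> \<open>At \<open>\<alpha>\<close> the remainder has the value of
        \<open>- ?q * p\<close>, so \<open>- u * ?q\<close> provides the inverse.\<close>
      have "poly (map_poly h (?q * p + ?r)) \<alpha> = 0" using \<mu>(2) by simp
      hence "poly (map_poly h ?r) \<alpha> = - (poly (map_poly h ?q) \<alpha> * poly (map_poly h p) \<alpha>)"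
        by (simp only: hp.hom_add hp.hom_mult poly_add poly_mult) (simp add: eq_neg_iff_add_eq_0 add.commute)
      hence "poly (map_poly h (- u * ?q * p)) \<alpha> = 1"
        using u by (simp add: hp.hom_mult hp.hom_uminus mult.assoc)
      thus ?thesis by blast
    qed
  qed
  have "degree (p mod \<mu>) < degree \<mu>"
    using degree_mod_less'[OF \<mu>(1), of p] degree_minimal_pos[OF \<mu>(1,2)] by (cases "p mod \<mu> = 0") auto
  then obtain r where "poly (map_poly h (r * (p mod \<mu>))) \<alpha> = 1"
    using small[of "p mod \<mu>"] p poly_map_mod[OF \<mu>(2)] by auto
  hence "poly (map_poly h p) \<alpha> * poly (map_poly h r) \<alpha> = 1"
    by (simp only: hp.hom_mult poly_mult poly_map_mod[OF \<mu>(2)] mult.commute)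
  hence "inverse (poly (map_poly h p) \<alpha>) = poly (map_poly h r) \<alpha>" by (rule inverse_unique)
  thus ?thesis by (intro exI[of _ r]) simp
qed

lemma is_subfield_poly_values:
  assumes "algebraic_over h \<alpha>"
  shows "is_subfield (range (\<lambda>p. poly (map_poly h p) \<alpha>))"
  unfolding is_subfield_def
proof (intro conjI ballI)
  show "0 \<in> range (\<lambda>p. poly (map_poly h p) \<alpha>)" by (rule range_eqI[of _ _ 0]) simp
  show "1 \<in> range (\<lambda>p. poly (map_poly h p) \<alpha>)" by (rule range_eqI[of _ _ 1]) simp
  fix x assume x: "x \<in> range (\<lambda>p. poly (map_poly h p) \<alpha>)"
  then obtain p where p: "x = poly (map_poly h p) \<alpha>" by blast
  show "inverse x \<in> range (\<lambda>p. poly (map_poly h p) \<alpha>)"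
  proof (cases "x = 0")
    case False
    then obtain r where "poly (map_poly h r) \<alpha> = inverse x"
      using algebraic_over_inverse[OF assms, of p] p by auto
    thus ?thesis by (metis rangeI)
  qed (use x in simp)
  fix y assume "y \<in> range (\<lambda>p. poly (map_poly h p) \<alpha>)"
  then obtain q where q: "y = poly (map_poly h q) \<alpha>" by blast
  show "x - y \<in> range (\<lambda>p. poly (map_poly h p) \<alpha>)"
    by (rule range_eqI[of _ _ "p - q"]) (simp add: p q hp.hom_minus)
  show "x * y \<in> range (\<lambda>p. poly (map_poly h p) \<alpha>)"
    by (rule range_eqI[of _ _ "p * q"]) (simp add: p q hp.hom_mult)
qed

text \<open>The polynomial values at \<open>\<alpha>\<close> form a subfield containing
  \<open>\<alpha>\<close> and the base field, so they contain the hull.\<close>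

lemma simple_field_extension_generates:
  assumes "simple_field_extension h" and alg: "\<And>x. algebraic_over h x"
  shows "\<exists>\<alpha>. generates h \<alpha>"
proof -
  obtain \<alpha> where \<alpha>: "is_subfield hull (insert \<alpha> (range h)) = UNIV"
    using assms(1) unfolding simple_field_extension_def by blast
  let ?S = "range (\<lambda>p. poly (map_poly h p) \<alpha>)"
  have "insert \<alpha> (range h) \<subseteq> ?S"
  proof -
    have "\<alpha> \<in> ?S" by (rule range_eqI[of _ _ "[:0, 1:]"]) simp
    moreover have "h a \<in> ?S" for a by (rule range_eqI[of _ _ "[:a:]"], unfold h.map_poly_pCons_hom hp.hom_zero poly_pCons poly_0, simp)
    ultimately show ?thesis by blast
  qed
  hence "is_subfield hull (insert \<alpha> (range h)) \<subseteq> ?S"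
    by (rule hull_minimal) (rule is_subfield_poly_values[OF alg])
  hence "?S = UNIV" unfolding \<alpha> by blast
  hence "\<exists>p. poly (map_poly h p) \<alpha> = x" for x by (metis (no_types, lifting) surjD)
  thus ?thesis unfolding generates_def by blast
qed

text \<open>The degree of the minimal polynomial serves as \<open>m\<close>; remainders modulo it
  represent all elements.\<close>

lemma generates_obtain_degree:
  assumes "generates h \<alpha>" and alg: "algebraic_over h \<alpha>"
  obtains m where "generates_with_degree h \<alpha> m"
proof -
  obtain \<mu> where \<mu>: "\<mu> \<noteq> 0" "poly (map_poly h \<mu>) \<alpha> = 0"
    "\<And>p. p \<noteq> 0 \<Longrightarrow> poly (map_poly h p) \<alpha> = 0 \<Longrightarrow> degree \<mu> \<le> degree p"
    using algebraic_over_minimal[OF alg] by blast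
  note pos = degree_minimal_pos[OF \<mu>(1,2)]
  have "degree (p mod \<mu>) < degree \<mu>" for p
    using degree_mod_less'[OF \<mu>(1), of p] pos by (cases "p mod \<mu> = 0") auto
  hence "\<exists>p. degree p < degree \<mu> \<and> poly (map_poly h p) \<alpha> = x" for x
    using assms(1) poly_map_mod[OF \<mu>(2)] unfolding generates_def by metis
  with \<mu> pos have "generates_with_degree h \<alpha> (degree \<mu>)"
    unfolding generates_with_degree_def by blast
  thus thesis by (rule that)
qed

lemma generates_with_degree_imp_sum:
  assumes "generates_with_degree h \<alpha> m"
  obtains y where "x = (\<Sum>k<m. h (y k) * \<alpha> ^ k)"
proof -
  obtain p where p: "degree p < m" "poly (map_poly h p) \<alpha> = x"
    using assms unfolding generates_with_degree_def by blast
  have "(\<Sum>k<m. h (coeff p k) * \<alpha> ^ k) = (\<Sum>k\<le>degree p. h (coeff p k) * \<alpha> ^ k)"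
    using p(1) by (intro sum.mono_neutral_right) (auto simp: coeff_eq_0)
  also have "\<dots> = x" using p(2) by (simp add: poly_altdef)
  finally show thesis using that by metis
qed

lemma generates_with_degree_independent:
  assumes "generates_with_degree h \<alpha> m" and "(\<Sum>k<m. h (y k) * \<alpha> ^ k) = 0" and "k < m"
  shows "y k = 0"
proof (rule ccontr)
  assume y: "y k \<noteq> 0"
  let ?p = "\<Sum>k<m. monom (y k) k"
  have c: "coeff ?p k = (if k < m then y k else 0)" for k
    by (simp add: coeff_sum)
  have "?p \<noteq> 0" using c[of k] y \<open>k < m\<close> by auto
  moreover have "poly (map_poly h ?p) \<alpha> = 0"
    using assms(2) by (simp add: hp.hom_sum poly_sum poly_monom)
  ultimately have "m \<le> degree ?p" using assms(1) unfolding generates_with_degree_def by blast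
  moreover have "degree ?p < m" using assms(3)
    by (intro degree_lessI) (auto simp: c)
  ultimately show False by simp
qed

end

text \<open>The \<open>m * n\<close> products of powers of \<open>\<beta>\<close> and
  \<open>\<gamma>\<close> are independent over the bottom field and lie in the span of
  \<open>d\<close> powers of \<open>\<delta>\<close>.\<close>

lemma tower_degree_le:
  fixes h :: "'k::field \<Rightarrow> 'l::field" and k :: "'l \<Rightarrow> 'm::field"
  assumes h: "inj_comm_ring_hom h" and k: "inj_comm_ring_hom k"
    and \<beta>: "generates_with_degree h \<beta> m" and \<gamma>: "generates_with_degree k \<gamma> n"
    and \<delta>: "generates_with_degree (k \<circ> h) \<delta> d"
  shows "m * n \<le> d"
proof -
  interpret h: inj_comm_ring_hom h by fact
  interpret k: inj_comm_ring_hom k by fact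
  define s where "s = (\<lambda>a x. k (h a) * x)"
  interpret V: vector_space s
    by unfold_locales (auto simp: s_def algebra_simps h.hom_add h.hom_mult k.hom_add k.hom_mult)
  have kh: "inj_comm_ring_hom (k \<circ> h)"
    by unfold_locales (auto simp: h.hom_add h.hom_mult k.hom_add k.hom_mult)
  define e where "e = (\<lambda>(i, j). k \<beta> ^ i * \<gamma> ^ j)"
  let ?I = "{..<m} \<times> {..<n}"
  have indep: "y i j = 0" if "(\<Sum>(i, j)\<in>?I. s (y i j) (e (i, j))) = 0" "i < m" "j < n" for y i j
  proof -
    have "(\<Sum>(i, j)\<in>?I. s (y i j) (e (i, j))) = (\<Sum>i<m. \<Sum>j<n. s (y i j) (e (i, j)))"
      by (simp add: sum.cartesian_product)
    also have "\<dots> = (\<Sum>j<n. \<Sum>i<m. s (y i j) (e (i, j)))" by (rule sum.swap)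
    also have "\<dots> = (\<Sum>j<n. k (\<Sum>i<m. h (y i j) * \<beta> ^ i) * \<gamma> ^ j)"
      by (simp add: s_def e_def k.hom_sum k.hom_mult k.hom_power sum_distrib_right mult.assoc)
    finally have "(\<Sum>j<n. k (\<Sum>i<m. h (y i j) * \<beta> ^ i) * \<gamma> ^ j) = 0" using that by simp
    from generates_with_degree_independent[OF k \<gamma> this \<open>j < n\<close>]
    show ?thesis using generates_with_degree_independent[OF h \<beta> _ \<open>i < m\<close>, of "\<lambda>i. y i j"] by blast
  qed
  \<comment> \<open>A coincidence of two products would be a relation with coefficients 1 and -1.
    Injectivity makes the number of vectors exactly \<open>m * n\<close>.\<close>
  have inj: "inj_on e ?I"
  proof (rule inj_onI, rule ccontr)
    fix u v assume uv: "u \<in> ?I" "v \<in> ?I" "e u = e v" "u \<noteq> v"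
    define y where "y = (\<lambda>i j. if (i, j) = u then 1 else if (i, j) = v then - 1 else (0::'k))"
    have "(\<Sum>(i, j)\<in>?I. s (y i j) (e (i, j))) = (\<Sum>w\<in>?I. (if w = u then e u else 0) - (if w = v then e v else 0))"
      using uv by (intro sum.cong refl) (simp add: y_def s_def case_prod_unfold h.hom_uminus k.hom_uminus)
    also have "\<dots> = 0" using uv by (simp add: sum_subtractf)
    finally have "y (fst u) (snd u) = 0" using uv by (intro indep) auto
    thus False by (simp add: y_def)
  qed
  have "V.independent (e ` ?I)"
  proof (rule V.independent_if_scalars_zero)
    show "finite (e ` ?I)" by simp
    fix f x assume 0: "(\<Sum>x\<in>e ` ?I. s (f x) x) = 0" and x: "x \<in> e ` ?I"
    then obtain i j where ij: "x = e (i, j)" "i < m" "j < n" by blast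
    have "(\<Sum>(i, j)\<in>?I. s (f (e (i, j))) (e (i, j))) = 0"
      using 0 by (simp add: sum.reindex[OF inj] case_prod_unfold)
    from indep[OF this ij(2,3)] show "f x = 0" by (simp add: ij)
  qed
  moreover have "e ` ?I \<subseteq> V.span ((\<lambda>i. \<delta> ^ i) ` {..<d})"
  proof
    fix x assume "x \<in> e ` ?I"
    obtain y where "x = (\<Sum>i<d. (k \<circ> h) (y i) * \<delta> ^ i)"
      using generates_with_degree_imp_sum[OF kh \<delta>] .
    also have "\<dots> \<in> V.span ((\<lambda>i. \<delta> ^ i) ` {..<d})"
    proof (rule V.span_sum)
      fix i assume "i \<in> {..<d}"
      hence "s (y i) (\<delta> ^ i) \<in> V.span ((\<lambda>i. \<delta> ^ i) ` {..<d})"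
        by (intro V.span_scale V.span_base) auto
      thus "(k \<circ> h) (y i) * \<delta> ^ i \<in> V.span ((\<lambda>i. \<delta> ^ i) ` {..<d})" by (simp add: s_def)
    qed
    finally show "x \<in> V.span ((\<lambda>i. \<delta> ^ i) ` {..<d})" .
  qed
  ultimately have "card (e ` ?I) \<le> card ((\<lambda>i. \<delta> ^ i) ` {..<d})"
    using V.independent_span_bound by blast
  also have "\<dots> \<le> d" using card_image_le[of "{..<d}" "\<lambda>i. \<delta> ^ i"] by simp
  finally show ?thesis by (simp add: card_image[OF inj])
qed

subsection \<open>Integral degree in a projective tower\<close>

lemma poly_fract_clear_denominators:
  fixes p :: "'a::idom fract poly"
  obtains a q where "a \<noteq> 0" "Polynomial.smult (to_fract a) p = map_poly to_fract q"
proof -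
  have "\<exists>a q. a \<noteq> 0 \<and> Polynomial.smult (to_fract a) p = map_poly to_fract q"
  proof (induction p)
    case 0
    show ?case by (rule exI[of _ 1], rule exI[of _ 0]) simp
  next
    case (pCons c p)
    interpret T: inj_comm_ring_hom "to_fract :: 'a \<Rightarrow> 'a fract" by unfold_locales auto
    obtain a q where a: "a \<noteq> 0" "Polynomial.smult (to_fract a) p = map_poly to_fract q"
      using pCons.IH by blast
    obtain n d where c: "c = Fract n d" "d \<noteq> 0" by (cases c) auto
    have "to_fract d * c = to_fract n"
      by (simp add: c to_fract_def eq_fract)
    hence "Polynomial.smult (to_fract (d * a)) (pCons c p) = map_poly to_fract (pCons (n * a) (Polynomial.smult d q))"
      using a(2) by (simp add: T.map_poly_pCons_hom T.map_poly_hom_smult mult.assoc mult.commute[of "to_fract a"]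
          mult.left_commute[of "to_fract a"] smult_smult[symmetric] del: smult_smult)
    thus ?case using a(1) c(2) by (metis mult_eq_0_iff)
  qed
  thus thesis using that by blast
qed

lemma fract_map_to_fract:
  assumes f: "inj_comm_ring_hom f"
  shows "fract_map f (to_fract a) = to_fract (f a)"
proof -
  interpret f: inj_comm_ring_hom f by fact
  show ?thesis by (simp add: to_fract_def fract_map_Fract[OF f])
qed

lemma poly_fract_map:
  assumes f: "inj_comm_ring_hom f"
  shows "poly (map_poly (fract_map f) (map_poly to_fract p)) (to_fract b) = to_fract (poly (map_poly f p) b)"
proof -
  interpret f: inj_comm_ring_hom f by fact
  interpret F: inj_comm_ring_hom "fract_map f" by (rule inj_comm_ring_hom_fract_map) fact
  interpret T: inj_comm_ring_hom "to_fract :: 'b \<Rightarrow> 'b fract" by unfold_locales auto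
  have "map_poly (fract_map f) (map_poly to_fract p) = map_poly to_fract (map_poly f p)"
    by (simp add: map_poly_map_poly o_def fract_map_to_fract[OF f])
  thus ?thesis by simp
qed

lemma integral_degree_elem_le:
  assumes "lead_coeff p = 1" "degree p = n" "1 \<le> n" "poly (map_poly f p) b = 0"
  shows "integral_degree_elem f b \<le> n"
  unfolding integral_degree_elem_def using assms by (intro Least_le) blast

lemma integral_degree_elem_attained:
  assumes "\<exists>p. lead_coeff p = 1 \<and> degree p > 0 \<and> poly (map_poly f p) b = 0"
  shows "1 \<le> integral_degree_elem f b \<and>
    (\<exists>p. lead_coeff p = 1 \<and> degree p = integral_degree_elem f b \<and> poly (map_poly f p) b = 0)"
  unfolding integral_degree_elem_def
  by (rule LeastI_ex) (use assms in \<open>auto intro: Suc_leI\<close>)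

text \<open>A monic equation of \<open>b\<close> over the ring is a nonzero equation over its
  fraction field, so its degree is at least \<open>m\<close>.\<close>

lemma to_fract_degree_le_integral_degree_elem:
  assumes f: "inj_comm_ring_hom f"
    and gen: "generates_with_degree (fract_map f) (to_fract b) m"
    and int: "\<exists>p. lead_coeff p = 1 \<and> degree p > 0 \<and> poly (map_poly f p) b = 0"
  shows "m \<le> integral_degree_elem f b"
proof -
  interpret T: inj_comm_ring_hom "to_fract :: 'a \<Rightarrow> 'a fract" by unfold_locales auto
  obtain p where p: "lead_coeff p = 1" "degree p = integral_degree_elem f b" "poly (map_poly f p) b = 0"
    using integral_degree_elem_attained[OF int] by blast
  have "poly (map_poly (fract_map f) (map_poly to_fract p)) (to_fract b) = 0"
    by (simp add: poly_fract_map[OF f] p(3))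
  moreover have "map_poly to_fract p \<noteq> (0 :: 'a fract poly)"
    using p(1) by (metis T.hom_lead_coeff leading_coeff_0_iff to_fract_1 zero_neq_one)
  ultimately have "m \<le> degree (map_poly to_fract p :: 'a fract poly)"
    using gen unfolding generates_with_degree_def by blast
  thus ?thesis using p(2) by simp
qed

lemma to_fract_generates_clear_denominators:
  assumes f: "inj_comm_ring_hom f" and gen: "generates_with_degree (fract_map f) (to_fract \<beta>) m"
  obtains a p where "a \<noteq> 0" "degree p < m" "f a * x = poly (map_poly f p) \<beta>"
proof -
  interpret T: inj_comm_ring_hom "to_fract :: 'a \<Rightarrow> 'a fract" by unfold_locales auto
  interpret F: inj_comm_ring_hom "fract_map f" by (rule inj_comm_ring_hom_fract_map) fact
  obtain P where P: "degree P < m" "poly (map_poly (fract_map f) P) (to_fract \<beta>) = to_fract x"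
    using gen unfolding generates_with_degree_def by blast
  obtain a q where a: "a \<noteq> 0" and q: "Polynomial.smult (to_fract a) P = map_poly to_fract q"
    using poly_fract_clear_denominators .
  have "degree (map_poly to_fract q :: 'a fract poly) = degree P" using a by (simp add: q[symmetric])
  hence "degree q < m" using P by simp
  moreover have "to_fract (poly (map_poly f q) \<beta>) = to_fract (f a * x)"
    unfolding poly_fract_map[OF f, symmetric] q[symmetric]
    by (simp add: F.map_poly_hom_smult P fract_map_to_fract[OF f])
  hence "f a * x = poly (map_poly f q) \<beta>" by (simp only: to_fract_eq_iff)
  ultimately show thesis using that a by blast
qed

text \<open>The matrix \<open>M\<close> has size \<open>card T * n\<close>, but over the fraction
  field of \<open>'a\<close> it factors through dimension \<open>m * n\<close>; this makes the
  degree independent of the number of generators.\<close>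

lemma projective_tower_integral:
  fixes f :: "'a::idom \<Rightarrow> 'b::idom" and g :: "'b \<Rightarrow> 'c::idom"
  assumes fin: "finite_ring_extension f" and proj: "projective_ring_extension f"
    and gen: "generates_with_degree (fract_map f) (to_fract \<beta>) m"
    and g: "inj_comm_ring_hom g"
    and p: "lead_coeff p = 1" "degree p = n" "n > 0" "poly (map_poly g p) c = 0"
  obtains q where "lead_coeff q = 1" "degree q = m * n" "poly (map_poly (g \<circ> f) q) c = 0"
proof (cases "c = 0")
  \<comment> \<open>Here no power of \<open>c\<close> can be cancelled, but a monomial of the right
    degree vanishes at \<open>c\<close>.\<close>
  case True
  have "m > 0" using gen by (simp add: generates_with_degree_def)
  interpret f: inj_comm_ring_hom f using fin by (simp add: finite_ring_extension_def)
  interpret g: inj_comm_ring_hom g by fact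
  interpret gf: inj_comm_ring_hom "g \<circ> f"
    by unfold_locales (auto simp: f.hom_add f.hom_mult g.hom_add g.hom_mult)
  show thesis
    using \<open>m > 0\<close> p(3) by (intro that[of "monom 1 (m * n)"]) (simp_all add: degree_monom_eq True poly_monom)
next
  case False
  interpret f: inj_comm_ring_hom f using fin by (simp add: finite_ring_extension_def)
  interpret g: inj_comm_ring_hom g by fact
  have gf: "inj_comm_ring_hom (g \<circ> f)"
    by unfold_locales (auto simp: f.hom_add f.hom_mult g.hom_add g.hom_mult)
  note f = f.inj_comm_ring_hom_axioms
  obtain S where S: "finite S" "Modules.module.span (ext_scale f) S = UNIV"
    using fin unfolding finite_ring_extension_def by blast
  have pm: "projective_module (ext_scale f)"
    using proj by (simp add: projective_ring_extension_def)
  obtain T :: "'b set" and x \<phi> where T: "finite T"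
    and \<phi>_add: "\<And>i b b'. \<phi> i (b + b') = \<phi> i b + \<phi> i b'"
    and scale: "\<And>i a b. \<phi> i (ext_scale f a b) = a * \<phi> i b"
    and rep': "\<And>b. b = (\<Sum>i\<in>T. ext_scale f (\<phi> i b) (x i))"
    by (rule projective_module_dual_basis[OF module_ext_scale[OF f] pm S]) blast
  note \<phi>_scale = scale[unfolded ext_scale_def] and rep = rep'[unfolded ext_scale_def]
  have \<phi>_0: "\<phi> i 0 = 0" for i using \<phi>_scale[of i 0 0] by simp
  have \<phi>_sum: "\<phi> i (sum u A) = (\<Sum>k\<in>A. \<phi> i (u k))" for i u and A :: "nat set"
    by (induction A rule: infinite_finite_induct) (simp_all add: \<phi>_0 \<phi>_add)
  have "\<exists>a z. a \<noteq> 0 \<and> f a * x j = (\<Sum>k<m. f (z k) * \<beta> ^ k)" for j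
  proof -
    obtain a r where r: "a \<noteq> 0" "degree r < m" "f a * x j = poly (map_poly f r) \<beta>"
      using to_fract_generates_clear_denominators[OF f gen] .
    have "poly (map_poly f r) \<beta> = (\<Sum>k\<le>degree r. f (coeff r k) * \<beta> ^ k)"
      by (simp add: poly_altdef)
    also have "\<dots> = (\<Sum>k<m. f (coeff r k) * \<beta> ^ k)"
      using r(2) by (intro sum.mono_neutral_left) (auto simp: coeff_eq_0)
    finally show ?thesis using r by metis
  qed
  then obtain a z where a: "\<And>j. a j \<noteq> 0" and z: "\<And>j. f (a j) * x j = (\<Sum>k<m. f (z j k) * \<beta> ^ k)"
    by metis
  \<comment> \<open>\<open>w\<close> is the companion matrix of \<open>p\<close>; \<open>M\<close> is multiplication by \<open>T\<close> on \<open>B[T]/(p)\<close> with respect to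
    the generators \<open>x\<^sub>i T\<^sup>k\<close>, and \<open>v\<close> consists of their images in \<open>C\<close>.\<close>
  define w where "w l k = (if Suc l < n then if k = Suc l then 1 else 0 else - coeff p k)" for l k
  \<comment> \<open>The powers of \<open>c\<close> form an eigenvector of the companion matrix; its
    last row expresses that \<open>c\<close> is a root of \<open>p\<close>.\<close>
  have w: "(\<Sum>k<n. g (w l k) * c ^ k) = c ^ Suc l" if "l < n" for l
  proof (cases "Suc l < n")
    case True
    have "(\<Sum>k<n. g (w l k) * c ^ k) = (\<Sum>k<n. if k = Suc l then c ^ k else 0)"
      using True by (intro sum.cong) (auto simp: w_def)
    thus ?thesis using True by simp
  next
    case False
    hence l: "Suc l = n" using that by simp
    have "0 = (\<Sum>k\<le>n. g (coeff p k) * c ^ k)" using p by (simp add: poly_altdef)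
    also have "\<dots> = (\<Sum>k<n. g (coeff p k) * c ^ k) + c ^ n"
      using p by (simp add: lessThan_Suc_atMost[symmetric])
    finally show ?thesis using False l
      by (simp add: w_def g.hom_uminus sum_negf eq_neg_iff_add_eq_0 add.commute minus_equation_iff neg_eq_iff_add_eq_0)
  qed
  let ?I = "T \<times> {..<n}" and ?J = "{..<m} \<times> {..<n}"
  define M where "M = (\<lambda>(j, l) (i, k). \<phi> i (w l k * x j))"
  \<comment> \<open>The intermediate space has the basis \<open>\<beta> ^ k' * T ^ l'\<close>, with
    \<open>T\<close> the polynomial variable. \<open>P\<close> holds the coordinates of the
    generators in this basis; \<open>Q\<close> multiplies a basis element by the variable and takes
    dual-basis coordinates.\<close>
  define P :: "'b \<times> nat \<Rightarrow> nat \<times> nat \<Rightarrow> 'a fract"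
    where "P = (\<lambda>(j, l) (k', l'). if l' = l then to_fract (z j k') / to_fract (a j) else 0)"
  define Q :: "nat \<times> nat \<Rightarrow> 'b \<times> nat \<Rightarrow> 'a fract"
    where "Q = (\<lambda>(k', l') (i, k). to_fract (\<phi> i (w l' k * \<beta> ^ k')))"
  define v where "v = (\<lambda>(i, k). g (x i) * c ^ k)"
  \<comment> \<open>The dual-basis expansion of 1 needs a nonzero \<open>x i\<close>; the component
    of \<open>v\<close> at \<open>(i, 0)\<close> is then nonzero, since
    \<open>c ^ 0 = 1\<close>.\<close>
  have "\<exists>i\<in>T. x i \<noteq> 0"
  proof (rule ccontr)
    assume "\<not> (\<exists>i\<in>T. x i \<noteq> 0)"
    hence "(\<Sum>i\<in>T. f (\<phi> i 1) * x i) = 0" by simp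
    thus False using rep[of 1] by simp
  qed
  then obtain i where i: "i \<in> T" "x i \<noteq> 0" by blast
  obtain q where "lead_coeff q = 1" "degree q = card ?J" "poly (map_poly (g \<circ> f) q) c = 0"
  proof (rule factored_eigen_imp_integral[OF gf, of ?I ?J M P Q v c "(i, 0)"])
    show "v (i, 0) \<noteq> 0" using i by (simp add: v_def)
    fix jl assume "jl \<in> ?I"
    then obtain j l where jl: "jl = (j, l)" "j \<in> T" "l < n" by blast
    have "(\<Sum>ik\<in>?I. (g \<circ> f) (M jl ik) * v ik) = (\<Sum>i\<in>T. \<Sum>k<n. g (f (\<phi> i (w l k * x j))) * (g (x i) * c ^ k))"
      unfolding sum.cartesian_product by (intro sum.cong) (auto simp: jl M_def v_def)
    also have "\<dots> = (\<Sum>k<n. \<Sum>i\<in>T. g (f (\<phi> i (w l k * x j))) * (g (x i) * c ^ k))" by (rule sum.swap)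
    also have "\<dots> = (\<Sum>k<n. g (\<Sum>i\<in>T. f (\<phi> i (w l k * x j)) * x i) * c ^ k)"
      by (simp add: g.hom_sum g.hom_mult sum_distrib_right mult.assoc)
    also have "\<dots> = (\<Sum>k<n. g (w l k * x j) * c ^ k)" by (simp only: rep[symmetric])
    also have "\<dots> = g (x j) * (\<Sum>k<n. g (w l k) * c ^ k)"
      by (simp add: g.hom_mult sum_distrib_left mult_ac)
    also have "\<dots> = c * v jl" by (simp add: w[OF jl(3)] jl v_def)
    finally show "(\<Sum>ik\<in>?I. (g \<circ> f) (M jl ik) * v ik) = c * v jl" .
    fix ik assume "ik \<in> ?I"
    then obtain i k where ik: "ik = (i, k)" by blast
    \<comment> \<open>Multiplying by \<open>a j\<close> allows \<open>x j\<close> to be replaced by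
      powers of \<open>\<beta>\<close> inside \<open>\<phi> i\<close>, which is linear over
      \<open>'a\<close>.\<close>
    have "a j * \<phi> i (w l k * x j) = \<phi> i (w l k * (f (a j) * x j))"
      by (subst \<phi>_scale[symmetric]) (simp add: mult_ac)
    also have "\<dots> = \<phi> i (\<Sum>k'<m. f (z j k') * (w l k * \<beta> ^ k'))"
      unfolding z sum_distrib_left by (simp add: mult_ac)
    also have "\<dots> = (\<Sum>k'<m. z j k' * \<phi> i (w l k * \<beta> ^ k'))"
      by (simp add: \<phi>_sum \<phi>_scale)
    finally have "to_fract (a j) * to_fract (\<phi> i (w l k * x j)) =
        (\<Sum>k'<m. to_fract (z j k') * to_fract (\<phi> i (w l k * \<beta> ^ k')))"
      by (simp flip: to_fract_mult to_fract_sum)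
    hence "to_fract (\<phi> i (w l k * x j)) =
        (\<Sum>k'<m. to_fract (z j k') / to_fract (a j) * to_fract (\<phi> i (w l k * \<beta> ^ k')))"
      using a[of j] by (simp add: sum_divide_distrib[symmetric] field_simps)
    also have "\<dots> = (\<Sum>k'<m. \<Sum>l'<n. if l' = l then to_fract (z j k') / to_fract (a j) * to_fract (\<phi> i (w l' k * \<beta> ^ k')) else 0)"
      using jl by simp
    also have "\<dots> = (\<Sum>t\<in>?J. P jl t * Q t ik)"
      unfolding sum.cartesian_product by (intro sum.cong) (auto simp: jl ik P_def Q_def)
    finally show "to_fract (M jl ik) = (\<Sum>t\<in>?J. P jl t * Q t ik)" by (simp add: jl ik M_def)
  qed (use T i p(3) False in auto)
  thus thesis using that by simp
qed

subsection \<open>The primitive element theorem\<close>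

lemma generates_with_degree_finite:
  fixes h :: "'k::field \<Rightarrow> 'l::field"
  assumes h: "inj_comm_ring_hom h" and gen: "generates_with_degree h \<alpha> m" and fin: "finite (UNIV :: 'k set)"
  shows "finite (UNIV :: 'l set)"
proof -
  let ?X = "{ys :: 'k list. set ys \<subseteq> UNIV \<and> length ys = m}"
  have "x \<in> (\<lambda>ys. \<Sum>k<m. h (ys ! k) * \<alpha> ^ k) ` ?X" for x
  proof -
    obtain y where "x = (\<Sum>k<m. h (y k) * \<alpha> ^ k)"
      using generates_with_degree_imp_sum[OF h gen] .
    thus ?thesis by (intro image_eqI[of _ _ "map y [0..<m]"]) auto
  qed
  hence "UNIV \<subseteq> (\<lambda>ys. \<Sum>k<m. h (ys ! k) * \<alpha> ^ k) ` ?X" by blast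
  thus ?thesis using finite_lists_length_eq[OF fin, of m] by (rule finite_surj[rotated])
qed

text \<open>The multiplicative group of a finite field is cyclic; the type is viewed as a ring
  record to apply this.\<close>

lemma finite_field_power_generator:
  assumes "finite (UNIV :: 'm::field set)"
  shows "\<exists>\<zeta> :: 'm. \<forall>x. x \<noteq> 0 \<longrightarrow> (\<exists>i. x = \<zeta> ^ i)"
proof -
  let ?R = "ring_of_type_algebra :: 'm ring"
  interpret R: field ?R by (rule field_from_type_algebra)
  have c: "carrier ?R = UNIV" and z: "\<zero>\<^bsub>?R\<^esub> = 0"
    by (simp_all add: ring_of_type_algebra_def)
  have pow: "x [^]\<^bsub>?R\<^esub> (i :: nat) = x ^ i" for x :: 'm and i
    by (induction i) (simp_all add: ring_of_type_algebra_def)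
  obtain a where "carrier (Multiplicative_Group.mult_of ?R) = {a [^]\<^bsub>?R\<^esub> i | i::nat. i \<in> UNIV}"
    using R.finite_field_mult_group_has_gen assms unfolding c by blast
  hence "- {0} = {a ^ i | i. i \<in> UNIV}" by (simp add: pow Multiplicative_Group.carrier_mult_of c z Compl_eq_Diff_UNIV)
  thus ?thesis by blast
qed

section \<open>Subfields and polynomials with coefficients in them\<close>

context
  fixes F :: "'m::field set"
  assumes F: "is_subfield F"
begin

lemma subfield_diff: "x \<in> F \<Longrightarrow> y \<in> F \<Longrightarrow> x - y \<in> F"
  and subfield_mult: "x \<in> F \<Longrightarrow> y \<in> F \<Longrightarrow> x * y \<in> F"
  and subfield_inverse: "x \<in> F \<Longrightarrow> inverse x \<in> F"
  and subfield_0: "0 \<in> F" and subfield_1: "1 \<in> F"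
  using F unfolding is_subfield_def by blast+

lemma subfield_uminus: "x \<in> F \<Longrightarrow> - x \<in> F"
  using subfield_diff[OF subfield_0] by simp

lemma subfield_add: "x \<in> F \<Longrightarrow> y \<in> F \<Longrightarrow> x + y \<in> F"
  using subfield_diff[OF _ subfield_uminus] by simp

lemma subfield_divide: "x \<in> F \<Longrightarrow> y \<in> F \<Longrightarrow> x / y \<in> F"
  by (simp add: field_class.field_divide_inverse subfield_mult subfield_inverse)

lemma subfield_sum: "(\<And>i. i \<in> A \<Longrightarrow> u i \<in> F) \<Longrightarrow> sum u A \<in> F"
  by (induction A rule: infinite_finite_induct) (simp_all add: subfield_0 subfield_add)

lemma subfield_power: "x \<in> F \<Longrightarrow> x ^ n \<in> F"
  by (induction n) (simp_all add: subfield_1 subfield_mult)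

lemma poly_in_subfield: "(\<And>i. coeff p i \<in> F) \<Longrightarrow> x \<in> F \<Longrightarrow> poly p x \<in> F"
  by (simp add: poly_altdef subfield_sum subfield_mult subfield_power)

lemma coeff_mult_in_subfield:
  "(\<And>i. coeff p i \<in> F) \<Longrightarrow> (\<And>i. coeff q i \<in> F) \<Longrightarrow> coeff (p * q) i \<in> F"
  by (simp add: coeff_mult subfield_sum subfield_mult)

lemma coeff_pcompose_in_subfield:
  assumes "\<And>i. coeff p i \<in> F" and q: "\<And>i. coeff q i \<in> F"
  shows "coeff (pcompose p q) i \<in> F"
  using assms(1)
proof (induction p arbitrary: i)
  case (pCons a p)
  have "coeff p i \<in> F" for i using pCons.prems[of "Suc i"] by simp
  hence "coeff (q * pcompose p q) i \<in> F" for i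
    using pCons.IH q by (intro coeff_mult_in_subfield) auto
  moreover have "coeff [:a:] i \<in> F" using pCons.prems[of 0] subfield_0
    by (simp add: coeff_pCons split: nat.split)
  ultimately show ?case by (simp add: pcompose_pCons subfield_add)
qed (simp add: subfield_0)

text \<open>A polynomial over \<open>F\<close> of least degree vanishing at \<open>\<beta>\<close> serves as the minimal polynomial of
  \<open>\<beta>\<close> over \<open>F\<close>, which is not available as a type.\<close>

lemma subfield_minimal_poly:
  assumes "p0 \<noteq> 0" "\<And>i. coeff p0 i \<in> F" "poly p0 \<beta> = 0"
  obtains r where "r \<noteq> 0" "\<And>i. coeff r i \<in> F" "poly r \<beta> = 0"
    "\<And>p. (\<And>i. coeff p i \<in> F) \<Longrightarrow> poly p \<beta> = 0 \<Longrightarrow> r dvd p"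
proof -
  let ?Q = "\<lambda>r. r \<noteq> 0 \<and> (\<forall>i. coeff r i \<in> F) \<and> poly r \<beta> = 0"
  have "?Q p0" using assms by simp
  then obtain r where r: "?Q r" and min: "\<And>p. ?Q p \<Longrightarrow> degree r \<le> degree p"
    using ex_has_least_nat[of ?Q p0 degree] by metis
  have "r dvd p" if "\<forall>i. coeff p i \<in> F" "poly p \<beta> = 0" for p
    using that
  proof (induction "degree p" arbitrary: p rule: less_induct)
    case (less p)
    show ?case
    proof (cases "p = 0")
      case False
      hence deg: "degree r \<le> degree p" using min[of p] less.prems by blast
      \<comment> \<open>Long division by \<open>r\<close> proceeds one leading term at a time, which
        keeps all coefficients in \<open>F\<close>.\<close>
      let ?c = "lead_coeff p / lead_coeff r"
      let ?u = "monom ?c (degree p - degree r)"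
      let ?w = "p - ?u * r"
      have c: "?c \<noteq> 0" using False r by simp
      have "\<forall>i. coeff ?u i \<in> F" using less.prems r by (simp add: subfield_divide subfield_0)
      hence w: "\<forall>i. coeff ?w i \<in> F"
        using less.prems r by (simp only: coeff_diff) (blast intro: subfield_diff coeff_mult_in_subfield)
      have w0: "poly ?w \<beta> = 0" using less.prems r by simp
      have "r dvd ?w"
      proof (cases "?w = 0")
        case nz: False
        have deg_u: "degree (?u * r) = degree p"
          using deg c r by (subst degree_mult_eq) (auto simp: degree_monom_eq)
        have "coeff ?w (degree p) = 0"
          using deg r by (simp add: coeff_monom_mult)
        moreover have "degree ?w \<le> degree p" using deg_u by (intro degree_diff_le) auto
        ultimately have "degree ?w < degree p"
          using nz by (metis leading_coeff_0_iff le_neq_implies_less)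
        from less.hyps[OF this w w0] show ?thesis .
      qed simp
      hence "r dvd ?w + ?u * r" by (intro dvd_add) simp_all
      thus ?thesis by simp
    qed simp
  qed
  thus thesis using that r by blast
qed

end

text \<open>The classical choice is \<open>\<delta> = \<gamma> + t \<beta>\<close> with
  \<open>t\<close> outside a finite set. Over the field generated by \<open>\<delta>\<close>, the
  minimal polynomial of \<open>\<beta>\<close> divides both \<open>P\<close> and
  \<open>G (\<delta> - t X)\<close>, hence is linear, so \<open>\<beta>\<close> and then
  \<open>\<gamma>\<close> lie in that field.\<close>

lemma primitive_element_infinite:
  fixes h :: "'k::field \<Rightarrow> 'l::field" and k :: "'l \<Rightarrow> 'm::field"
  assumes h: "inj_comm_ring_hom h" and k: "inj_comm_ring_hom k"
    and inf: "infinite (UNIV :: 'k set)"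
    and \<beta>: "generates h \<beta>" and \<gamma>: "generates k \<gamma>"
    and alg: "\<And>x. algebraic_over (k \<circ> h) x"
    and P: "poly (map_poly h P) \<beta> = 0" "poly (map_poly h (pderiv P)) \<beta> \<noteq> 0"
  shows "\<exists>\<delta>. generates (k \<circ> h) \<delta>"
proof -
  interpret h: inj_comm_ring_hom h by fact
  interpret k: inj_comm_ring_hom k by fact
  define H where "H = k \<circ> h"
  interpret H: inj_comm_ring_hom H
    by unfold_locales (auto simp: H_def h.hom_add h.hom_mult k.hom_add k.hom_mult)
  interpret H: idom_hom H ..
  interpret E: inj_comm_ring_hom "to_ac :: 'm \<Rightarrow> 'm alg_closure" by unfold_locales auto
  interpret E: idom_hom "to_ac :: 'm \<Rightarrow> 'm alg_closure" ..
  interpret EP: map_poly_inj_comm_ring_hom "to_ac :: 'm \<Rightarrow> 'm alg_closure" by unfold_locales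
  obtain G where G: "G \<noteq> 0" "poly (map_poly H G) \<gamma> = 0"
    using alg[of \<gamma>] unfolding algebraic_over_def H_def by blast
  define PM where "PM = map_poly H P"
  define GM where "GM = map_poly H G"
  define PN where "PN = map_poly to_ac PM"
  define GN where "GN = map_poly to_ac GM"
  define b where "b = k \<beta>"
  have mHk: "map_poly H p = map_poly k (map_poly h p)" for p
    by (simp add: H_def map_poly_map_poly)
  have P1: "poly PM b = 0" using P(1) by (simp add: PM_def b_def mHk)
  have P2: "poly (pderiv PM) b \<noteq> 0"
  proof -
    have "pderiv PM = map_poly k (map_poly h (pderiv P))"
      unfolding PM_def H.map_poly_pderiv[symmetric] by (rule mHk)
    thus ?thesis using P(2) by (simp add: b_def)
  qed
  hence PM0: "PM \<noteq> 0" by auto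
  have GN0: "GN \<noteq> 0" "PN \<noteq> 0" using G PM0 by (auto simp: GN_def GM_def PN_def)
  \<comment> \<open>The \<open>t\<close> for which \<open>\<gamma> + t \<beta> = r + t s\<close> for some conjugates \<open>r\<close> of \<open>\<gamma>\<close> and \<open>s \<noteq> \<beta>\<close> of \<open>\<beta>\<close>.\<close>
  define bad where "bad = (\<lambda>(r, s). (r - to_ac \<gamma>) / (to_ac b - s)) ` ({r. poly GN r = 0} \<times> {s. poly PN s = 0})"
  have "finite bad" unfolding bad_def using GN0 by (intro finite_imageI finite_cartesian_product poly_roots_finite)
  moreover have "infinite (range (\<lambda>a. to_ac (H a)))"
    using inf by (subst finite_image_iff) (auto simp: inj_on_def)
  ultimately have "\<not> range (\<lambda>a. to_ac (H a)) \<subseteq> bad" using finite_subset by blast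
  then obtain t where t: "to_ac (H t) \<notin> bad" by blast
  define \<delta> where "\<delta> = \<gamma> + H t * b"
  let ?F = "range (\<lambda>p. poly (map_poly H p) \<delta>)"
  have "algebraic_over H \<delta>" using alg by (simp add: H_def)
  hence F: "is_subfield ?F"
    using is_subfield_poly_values[OF H.inj_comm_ring_hom_axioms] by blast
  have HF: "H a \<in> ?F" for a
    by (rule range_eqI[of _ _ "monom a 0"]) (simp add: poly_monom)
  have \<delta>F: "\<delta> \<in> ?F"
    by (rule range_eqI[of _ _ "monom 1 1"]) (simp add: poly_monom)
  \<comment> \<open>This is \<open>G (\<delta> - t X)\<close>: it has coefficients in
    \<open>?F\<close> and vanishes at \<open>b\<close> because
    \<open>\<delta> - t b = \<gamma>\<close>.\<close>
  define Q where "Q = pcompose GM [:\<delta>, - H t:]"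
  have Q1: "poly Q b = 0" using G(2) by (simp add: Q_def poly_pcompose GM_def \<delta>_def)
  have QF: "coeff Q i \<in> ?F" for i
    unfolding Q_def
  proof (rule coeff_pcompose_in_subfield[OF F])
    show "coeff GM i \<in> ?F" for i using HF by (simp add: GM_def)
    show "coeff [:\<delta>, - H t:] i \<in> ?F" for i
      using \<delta>F subfield_uminus[OF F HF] subfield_0[OF F] by (auto simp: coeff_pCons split: nat.split)
  qed
  have PF: "coeff PM i \<in> ?F" for i using HF by (simp add: PM_def)
  obtain r where r: "r \<noteq> 0" "\<And>i. coeff r i \<in> ?F" "poly r b = 0"
    and r_dvd: "\<And>p. (\<And>i. coeff p i \<in> ?F) \<Longrightarrow> poly p b = 0 \<Longrightarrow> r dvd p"
    using subfield_minimal_poly[OF F PM0 PF P1] by blast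
  let ?r = "map_poly to_ac r"
  have r_PN: "?r dvd PN" and r_QN: "?r dvd map_poly to_ac Q"
    unfolding PN_def using r_dvd[OF PF P1] r_dvd[OF QF Q1] by (auto intro: EP.hom_dvd)
  \<comment> \<open>By the choice of \<open>t\<close>, \<open>b\<close> is the only common root of \<open>PN\<close> and \<open>Q\<close>, and it is a simple root of \<open>PN\<close>.\<close>
  have deg: "degree r = 1"
  proof (rule ccontr)
    assume "degree r \<noteq> 1"
    moreover have "degree r \<noteq> 0"
    proof
      assume "degree r = 0"
      then obtain a where "r = [:a:]" by (rule degree_eq_zeroE)
      thus False using r(1,3) by simp
    qed
    ultimately have "degree r > 1" by simp
    have "poly ?r (to_ac b) = 0" using r(3) by simp
    hence "[:- to_ac b, 1:] dvd ?r" by (simp only: poly_eq_0_iff_dvd)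
    then obtain q where q: "?r = [:- to_ac b, 1:] * q" by (rule dvdE)
    hence "q \<noteq> 0" using r(1) by auto
    hence "degree ([:- to_ac b, 1:] * q) = 1 + degree q" by (subst degree_mult_eq) auto
    hence "degree r = 1 + degree q" unfolding q[symmetric] by simp
    hence "degree q > 0" using \<open>degree r > 1\<close> by simp
    \<comment> \<open>A root of the cofactor is either a second common root or a repetition of
      \<open>to_ac b\<close>; both are excluded below.\<close>
    then obtain s where s: "poly q s = 0" using alg_closed_imp_poly_has_root by blast
    hence "poly ?r s = 0" by (simp add: q)
    hence sP: "poly PN s = 0" and sQ: "poly (map_poly to_ac Q) s = 0"
      using r_PN r_QN by (auto elim!: dvdE)
    have "poly GN (to_ac \<delta> - to_ac (H t) * s) = 0"
      using sQ by (simp add: Q_def GN_def E.map_poly_pcompose poly_pcompose E.map_poly_pCons_hom algebra_simps)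
    \<comment> \<open>If \<open>s\<close> differs from \<open>to_ac b\<close>, this quotient is the
      image of \<open>t\<close>, which was chosen outside \<open>bad\<close>.\<close>
    hence "(to_ac \<delta> - to_ac (H t) * s - to_ac \<gamma>) / (to_ac b - s) \<in> bad"
      unfolding bad_def using sP by (intro image_eqI[of _ _ "(to_ac \<delta> - to_ac (H t) * s, s)"]) auto
    moreover have "(to_ac \<delta> - to_ac (H t) * s - to_ac \<gamma>) / (to_ac b - s) = to_ac (H t)" if "s \<noteq> to_ac b"
      using that by (simp add: \<delta>_def field_simps)
    ultimately have "s = to_ac b" using t by metis
    \<comment> \<open>Now \<open>to_ac b\<close> is a double root of \<open>PN\<close>, against the
      nonvanishing derivative.\<close>
    obtain u where "PN = ?r * u" using r_PN by blast
    hence "PN = [:- to_ac b, 1:] * (q * u)" by (simp only: q mult.assoc)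
    hence "poly (pderiv PN) (to_ac b) = 0"
      using s \<open>s = to_ac b\<close> by (simp add: pderiv_mult pderiv_pCons del: mult_pCons_left)
    hence "to_ac (poly (pderiv PM) b) = 0"
      by (simp add: PN_def E.map_poly_pderiv[symmetric])
    thus False using P2 by simp
  qed
  have bF: "b \<in> ?F"
  proof -
    have "coeff r 1 \<noteq> 0" using deg r(1) by (metis leading_coeff_0_iff)
    moreover have "coeff r 0 + coeff r 1 * b = 0"
      using r(3) deg by (simp add: poly_altdef)
    ultimately have "b = - coeff r 0 / coeff r 1"
      by (simp add: field_simps eq_neg_iff_add_eq_0 add.commute)
    thus ?thesis using subfield_divide[OF F subfield_uminus[OF F r(2)] r(2)] by metis
  qed
  have \<gamma>F: "\<gamma> \<in> ?F"
  proof -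
    have "\<gamma> = \<delta> - H t * b" by (simp add: \<delta>_def)
    thus ?thesis using subfield_diff[OF F \<delta>F subfield_mult[OF F HF bF]] by simp
  qed
  have kF: "k y \<in> ?F" for y
  proof -
    obtain p where "y = poly (map_poly h p) \<beta>" using \<beta> unfolding generates_def by metis
    hence "k y = poly (map_poly H p) b" by (simp add: mHk b_def)
    moreover have "\<dots> \<in> ?F" by (rule poly_in_subfield[OF F _ bF]) (simp add: HF)
    ultimately show ?thesis by simp
  qed
  have "x \<in> ?F" for x
  proof -
    obtain p where "x = poly (map_poly k p) \<gamma>" using \<gamma> unfolding generates_def by metis
    moreover have "\<dots> \<in> ?F" by (rule poly_in_subfield[OF F _ \<gamma>F]) (simp add: kF)
    ultimately show ?thesis by simp
  qed
  hence "\<exists>p. poly (map_poly H p) \<delta> = x" for x by (metis (no_types, lifting) imageE)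
  thus ?thesis unfolding generates_def H_def by blast
qed

text \<open>For finite \<open>'k\<close> the top field is finite and a generator of its
  multiplicative group works. For infinite \<open>'k\<close>, separability makes
  \<open>\<beta>\<close> a simple root of the polynomial \<open>P\<close>.\<close>

lemma primitive_element:
  fixes h :: "'k::field \<Rightarrow> 'l::field" and k :: "'l \<Rightarrow> 'm::field"
  assumes h: "inj_comm_ring_hom h" and k: "inj_comm_ring_hom k"
    and \<beta>: "generates_with_degree h \<beta> m" and \<gamma>: "generates_with_degree k \<gamma> n"
    and alg: "\<And>x. algebraic_over (k \<circ> h) x"
    and sep: "separable_field_extension h"
  shows "\<exists>\<delta>. generates (k \<circ> h) \<delta>"
proof (cases "finite (UNIV :: 'k set)")
  case True
  interpret h: inj_comm_ring_hom h by fact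
  interpret k: inj_comm_ring_hom k by fact
  interpret H: inj_comm_ring_hom "k \<circ> h"
    by unfold_locales (auto simp: h.hom_add h.hom_mult k.hom_add k.hom_mult)
  have "finite (UNIV :: 'm set)"
    using generates_with_degree_finite[OF k \<gamma> generates_with_degree_finite[OF h \<beta> True]] .
  then obtain \<zeta> :: 'm where \<zeta>: "\<And>x. x \<noteq> 0 \<Longrightarrow> \<exists>i. x = \<zeta> ^ i"
    using finite_field_power_generator by blast
  have "\<exists>p. poly (map_poly (k \<circ> h) p) \<zeta> = x" for x
  proof (cases "x = 0")
    case True
    thus ?thesis by (intro exI[of _ 0]) simp
  next
    case False
    then obtain i where "x = \<zeta> ^ i" using \<zeta> by blast
    thus ?thesis by (intro exI[of _ "monom 1 i"]) (simp add: poly_monom)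
  qed
  thus ?thesis unfolding generates_def by blast
next
  case False
  interpret h: inj_comm_ring_hom h by fact
  interpret hp: map_poly_inj_comm_ring_hom h by unfold_locales
  obtain P where P: "lead_coeff P = 1" "poly (map_poly h P) \<beta> = 0" "coprime P (pderiv P)"
    using sep unfolding separable_field_extension_def by blast
  have "algebraic_over h \<beta>" unfolding algebraic_over_def using P by (intro exI[of _ P]) auto
  then obtain \<mu> where \<mu>: "\<mu> \<noteq> 0" "poly (map_poly h \<mu>) \<beta> = 0"
    "\<And>p. p \<noteq> 0 \<Longrightarrow> poly (map_poly h p) \<beta> = 0 \<Longrightarrow> degree \<mu> \<le> degree p"
    using algebraic_over_minimal by blast
  \<comment> \<open>If the derivative of \<open>P\<close> also vanished at \<open>\<beta>\<close>,
    the nonunit \<open>\<mu>\<close> would divide both \<open>P\<close> and its derivative,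
    contradicting coprimality.\<close>
  have "\<mu> dvd p" if "poly (map_poly h p) \<beta> = 0" for p
  proof (rule ccontr)
    assume "\<not> \<mu> dvd p"
    hence nz: "p mod \<mu> \<noteq> 0" by (simp add: dvd_eq_mod_eq_0)
    hence "degree \<mu> \<le> degree (p mod \<mu>)"
      using \<mu>(3) poly_map_mod[OF h \<mu>(2), of p] that by simp
    thus False using degree_mod_less'[OF \<mu>(1) nz] by simp
  qed
  moreover have "\<not> is_unit \<mu>"
    using degree_minimal_pos[OF h \<mu>(1,2)] by (auto simp: is_unit_iff_degree[OF \<mu>(1)])
  ultimately have "poly (map_poly h (pderiv P)) \<beta> \<noteq> 0"
    using P(2,3) coprime_common_divisor by blast
  moreover have "generates h \<beta>" "generates k \<gamma>"
    using \<beta> \<gamma> unfolding generates_with_degree_def generates_def by blast+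
  ultimately show ?thesis
    using primitive_element_infinite[OF h k False _ _ alg P(2)] by blast
qed

subsection \<open>Extensions of fraction fields\<close>

text \<open>A nonzero constant term of \<open>q\<close> is a multiple of \<open>s\<close> and serves
  as \<open>a\<close>; a zero one allows cancelling \<open>s\<close> and passing to lower
  degree.\<close>

lemma integral_dvd_base:
  fixes f :: "'a::idom \<Rightarrow> 'b::idom"
  assumes f: "inj_comm_ring_hom f" and "q \<noteq> 0" "poly (map_poly f q) s = 0" "s \<noteq> 0"
  shows "\<exists>a. a \<noteq> 0 \<and> s dvd f a"
  using assms(2,3)
proof (induction q)
  case (pCons a q)
  interpret f: inj_comm_ring_hom f by fact
  have eq: "f a + s * poly (map_poly f q) s = 0"
    using pCons.prems by (simp add: f.map_poly_pCons_hom)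
  show ?case
  proof (cases "a = 0")
    case True
    thus ?thesis using pCons eq \<open>s \<noteq> 0\<close> by auto
  next
    case False
    have "f a = s * - poly (map_poly f q) s" using eq by (simp add: eq_neg_iff_add_eq_0)
    thus ?thesis using False by (metis dvd_triv_left)
  qed
qed simp

context
  fixes f :: "'a::idom \<Rightarrow> 'b::idom"
  assumes f: "inj_comm_ring_hom f"
    and int: "\<And>b. \<exists>p. lead_coeff p = 1 \<and> degree p > 0 \<and> poly (map_poly f p) b = 0"
begin

interpretation f: inj_comm_ring_hom f by (fact f)
interpretation F: inj_comm_ring_hom "fract_map f" by (rule inj_comm_ring_hom_fract_map[OF f])
interpretation T: inj_comm_ring_hom "to_fract :: 'a \<Rightarrow> 'a fract" by unfold_locales auto

text \<open>The denominator of \<open>x\<close> divides a nonzero element of the base ring, so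
  denominators can be taken there.\<close>

lemma integral_fract_cases:
  obtains b a where "a \<noteq> 0" "fract_map f (to_fract a) * x = to_fract b"
proof -
  obtain y s where x: "x = Fract y s" "s \<noteq> 0" by (cases x) auto
  obtain p where p: "lead_coeff p = 1" "poly (map_poly f p) s = 0" using int by blast
  hence "p \<noteq> 0" by auto
  then obtain a where a0: "a \<noteq> 0" "s dvd f a"
    using integral_dvd_base[OF f _ p(2) x(2)] by blast
  then obtain s' where a: "a \<noteq> 0" "f a = s * s'" unfolding dvd_def by blast
  have "fract_map f (to_fract a) * x = to_fract (y * s')"
    unfolding fract_map_to_fract[OF f] using x a by (simp add: to_fract_def eq_fract mult_ac)
  thus thesis using that a by blast
qed

text \<open>Substituting \<open>a X\<close> into an integral equation of \<open>b = a x\<close>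
  gives a nonzero equation for \<open>x\<close>.\<close>

lemma algebraic_over_fract_map: "algebraic_over (fract_map f) x"
proof -
  obtain a b where a: "a \<noteq> 0" "fract_map f (to_fract a) * x = to_fract b" by (rule integral_fract_cases)
  obtain p where p: "lead_coeff p = 1" "poly (map_poly f p) b = 0" using int by blast
  let ?P = "pcompose (map_poly to_fract p) [:0, to_fract a:]"
  have "map_poly to_fract p \<noteq> (0 :: 'a fract poly)" using p(1) by auto
  hence "?P \<noteq> 0" using a(1) pcompose_eq_0[of "map_poly to_fract p" "[:0, to_fract a:]"] by auto
  moreover have "poly (map_poly (fract_map f) ?P) x = 0"
    by (simp add: F.map_poly_pcompose F.map_poly_pCons_hom poly_pcompose mult.commute[of x] a(2)
        poly_fract_map[OF f] p(2))
  ultimately show ?thesis unfolding algebraic_over_def by blast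
qed

text \<open>Scaling a generator by a nonzero element of the base field leaves it a generator and
  moves it into the ring.\<close>

lemma generates_to_fract:
  assumes "generates (fract_map f) \<alpha>"
  shows "\<exists>\<beta>. generates (fract_map f) (to_fract \<beta>)"
proof -
  obtain a b where a: "a \<noteq> 0" and b: "fract_map f (to_fract a) * \<alpha> = to_fract b"
    by (rule integral_fract_cases)
  have "inverse (to_fract a) * to_fract a = 1" using a by simp
  hence "fract_map f (inverse (to_fract a)) * fract_map f (to_fract a) = 1"
    by (metis F.hom_mult F.hom_one)
  hence \<alpha>: "fract_map f (inverse (to_fract a)) * to_fract b = \<alpha>"
    by (simp add: b[symmetric] mult.assoc[symmetric])
  have "\<exists>q. poly (map_poly (fract_map f) q) (to_fract b) = x" for x
  proof -
    obtain p where p: "poly (map_poly (fract_map f) p) \<alpha> = x"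
      using assms unfolding generates_def by blast
    show ?thesis
      by (rule exI[of _ "pcompose p [:0, inverse (to_fract a):]"])
        (simp add: F.map_poly_pcompose F.map_poly_pCons_hom poly_pcompose mult.commute[of "to_fract b"] \<alpha> p)
  qed
  thus ?thesis unfolding generates_def by blast
qed

lemma generates_with_degree_to_fract:
  assumes "generates (fract_map f) \<alpha>"
  shows "\<exists>\<beta> m. generates_with_degree (fract_map f) (to_fract \<beta>) m"
  using generates_to_fract[OF assms]
    generates_obtain_degree[OF F.inj_comm_ring_hom_axioms _ algebraic_over_fract_map] by metis

lemma simple_imp_generates_with_degree:
  assumes "simple_field_extension (fract_map f)"
  shows "\<exists>\<beta> m. generates_with_degree (fract_map f) (to_fract \<beta>) m"
  using generates_with_degree_to_fract
    simple_field_extension_generates[OF F.inj_comm_ring_hom_axioms assms algebraic_over_fract_map] by blast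

lemma degree_le_integral_degree:
  assumes "generates_with_degree (fract_map f) (to_fract \<beta>) m"
  shows "enat m \<le> integral_degree f"
proof -
  have "enat m \<le> enat (integral_degree_elem f \<beta>)"
    using to_fract_degree_le_integral_degree_elem[OF f assms int] by simp
  also have "\<dots> \<le> integral_degree f" unfolding integral_degree_def by (rule SUP_upper) simp
  finally show ?thesis .
qed

end

section \<open>Integral degrees of projective extensions and of towers\<close>

lemma integral_degree_le:
  assumes fin: "finite_ring_extension f" and proj: "projective_ring_extension f"
    and gen: "generates_with_degree (fract_map f) (to_fract \<beta>) m"
  shows "integral_degree f \<le> enat m"
  unfolding integral_degree_def
proof (rule SUP_least)
  fix b
  have m: "m > 0" using gen by (simp add: generates_with_degree_def)
  have id: "inj_comm_ring_hom (id :: 'b \<Rightarrow> 'b)" by unfold_locales auto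
  \<comment> \<open>The degenerate tower with identity on top: \<open>b\<close> is a root of the
    linear polynomial \<open>X - b\<close>.\<close>
  obtain q where "lead_coeff q = 1" "degree q = m * 1" "poly (map_poly (id \<circ> f) q) b = 0"
    by (rule projective_tower_integral[OF fin proj gen id, of "[:- b, 1:]" 1 b]) (auto simp: map_poly_id)
  thus "enat (integral_degree_elem f b) \<le> enat m"
    using integral_degree_elem_le[of q m f b] m by simp
qed

theorem corollary5p5:
  fixes f :: "'a::idom \<Rightarrow> 'b::idom" and g :: "'b \<Rightarrow> 'c::idom"
  assumes "finite_ring_extension f" and "finite_ring_extension g"
    and "projective_ring_extension f"
    and "simple_field_extension (fract_map f)"
  shows "integral_degree (g \<circ> f) \<le> integral_degree f * integral_degree g \<and>
    (separable_field_extension (fract_map f) \<and> projective_ring_extension g \<and>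
       simple_field_extension (fract_map g) \<longrightarrow>
     integral_degree (g \<circ> f) = integral_degree f * integral_degree g)"
proof -
  have f: "inj_comm_ring_hom f" and g: "inj_comm_ring_hom g"
    using assms(1,2) by (auto simp: finite_ring_extension_def)
  interpret f: inj_comm_ring_hom f by fact
  interpret g: inj_comm_ring_hom g by fact
  have gf: "inj_comm_ring_hom (g \<circ> f)"
    by unfold_locales (auto simp: f.hom_add f.hom_mult g.hom_add g.hom_mult)
  note int_f = finite_ring_extension_integral[OF assms(1)]
  note int_g = finite_ring_extension_integral[OF assms(2)]
  obtain \<beta> m where \<beta>: "generates_with_degree (fract_map f) (to_fract \<beta>) m"
    using simple_imp_generates_with_degree[OF f int_f assms(4)] by blast
  have m: "m > 0" using \<beta> by (simp add: generates_with_degree_def)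
  \<comment> \<open>A monic equation for \<open>c\<close> of least degree over \<open>'b\<close> is
    converted to one over \<open>'a\<close>. Its positive degree makes it admissible for the
    integral degree and also shows integrality of the composite.\<close>
  have tower: "\<exists>q. lead_coeff q = 1 \<and> degree q = m * integral_degree_elem g c \<and>
      0 < m * integral_degree_elem g c \<and> poly (map_poly (g \<circ> f) q) c = 0" for c
  proof -
    obtain p where p: "1 \<le> integral_degree_elem g c" "lead_coeff p = 1"
      "degree p = integral_degree_elem g c" "poly (map_poly g p) c = 0"
      using integral_degree_elem_attained[OF int_g] by blast
    hence "0 < integral_degree_elem g c" by simp
    with projective_tower_integral[OF assms(1,3) \<beta> g p(2,3) _ p(4)] m show ?thesis
      by (metis nat_0_less_mult_iff)
  qed
  have le: "integral_degree (g \<circ> f) \<le> integral_degree f * integral_degree g"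
    unfolding integral_degree_def[of "g \<circ> f"]
  proof (rule SUP_least)
    fix c
    have "integral_degree_elem (g \<circ> f) c \<le> m * integral_degree_elem g c"
      using tower[of c] integral_degree_elem_le[of _ "m * integral_degree_elem g c" "g \<circ> f" c]
      by (auto simp: Suc_le_eq)
    hence "enat (integral_degree_elem (g \<circ> f) c) \<le> enat m * enat (integral_degree_elem g c)" by simp
    also have "\<dots> \<le> integral_degree f * integral_degree g"
    proof (rule mult_mono)
      \<comment> \<open>The field generator was chosen inside the ring, so its own integral degree
        is at least \<open>m\<close>.\<close>
      show "enat m \<le> integral_degree f" by (rule degree_le_integral_degree[OF f int_f \<beta>])
      show "enat (integral_degree_elem g c) \<le> integral_degree g"
        unfolding integral_degree_def by (rule SUP_upper) simp
    qed simp_all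
    finally show "enat (integral_degree_elem (g \<circ> f) c) \<le> integral_degree f * integral_degree g" .
  qed
  have "integral_degree (g \<circ> f) = integral_degree f * integral_degree g"
    if sep: "separable_field_extension (fract_map f)" and proj: "projective_ring_extension g"
      and simple: "simple_field_extension (fract_map g)"
  proof (rule antisym[OF le])
    obtain \<gamma> n where \<gamma>: "generates_with_degree (fract_map g) (to_fract \<gamma>) n"
      using simple_imp_generates_with_degree[OF g int_g simple] by blast
    have comp: "fract_map (g \<circ> f) = fract_map g \<circ> fract_map f"
    proof
      fix x :: "'a fract"
      obtain a b where "x = Fract a b" "b \<noteq> 0" by (cases x) auto
      thus "fract_map (g \<circ> f) x = (fract_map g \<circ> fract_map f) x"
        by (simp add: fract_map_Fract[OF f] fract_map_Fract[OF g] fract_map_Fract[OF gf])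
    qed
    have int_gf: "\<exists>q. lead_coeff q = 1 \<and> degree q > 0 \<and> poly (map_poly (g \<circ> f) q) c = 0" for c
      using tower[of c] by metis
    note F = inj_comm_ring_hom_fract_map[OF f] and G = inj_comm_ring_hom_fract_map[OF g]
    have "\<exists>\<delta>. generates (fract_map (g \<circ> f)) \<delta>"
      using primitive_element[OF F G \<beta> \<gamma> _ sep] algebraic_over_fract_map[OF gf int_gf]
      by (simp add: comp)
    then obtain \<delta> d where \<delta>: "generates_with_degree (fract_map (g \<circ> f)) (to_fract \<delta>) d"
      using generates_with_degree_to_fract[OF gf int_gf] by blast
    \<comment> \<open>Projectivity of both extensions bounds their integral degrees by the field
      degrees, whose product is at most the degree \<open>d\<close> of the composite.\<close>
    have "integral_degree f * integral_degree g \<le> enat m * enat n"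
      using integral_degree_le[OF assms(1,3) \<beta>] integral_degree_le[OF assms(2) proj \<gamma>]
      by (intro mult_mono) simp_all
    also have "\<dots> \<le> enat d"
      using tower_degree_le[OF F G \<beta> \<gamma> \<delta>[unfolded comp]] by simp
    also have "\<dots> \<le> integral_degree (g \<circ> f)"
      by (rule degree_le_integral_degree[OF gf int_gf \<delta>])
    finally show "integral_degree f * integral_degree g \<le> integral_degree (g \<circ> f)" .
  qed
  with le show ?thesis by blast
qed

end
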